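(* Let $R$ be an affine smooth Poisson algebra of dimension $n$ with trivial canonical bundle $\Omega^n(R)\cong R\,\mathrm{vol}$, and let $S=R[y_1,y_2]$ be a Poisson double extension of $R$ with variables $y_1,y_2$ and PDE-data $\{q,\alpha,\nu,w\}$. Let $\phi$ and $\psi$ be the modular derivations of $R$ and $S$ with respect to the volume forms $\mathrm{vol}$ and $\mathrm{vol}\wedge dy_1\wedge dy_2$, respectively. Then the restriction of $\psi$ to $R$ is $$\psi|_R=\phi-\alpha_{11}-\alpha_{22},$$ and $$\begin{aligned}\psi(y_1)&=(u_{11}-q_{12})y_1+u_{12}y_2+v_1-w_2,\\ \psi(y_2)&=(u_{21}+2q_{11})y_1+(u_{22}+q_{12})y_2+v_2+w_1,\end{aligned}$$ where $u_{11},u_{12},u_{21},u_{22},v_1,v_2\in R$ are determined by $\mathscr{L}_{\alpha_{ij}}(\mathrm{vol})=u_{ij}\,\mathrm{vol}$ and $\mathscr{L}_{\nu_i}(\mathrm{vol})=v_i\,\mathrm{vol}$ for $i,j\in\{1,2\}$.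
   Context: ${\bf k}$ is a field of characteristic zero. A Poisson algebra is a commutative ${\bf k}$-algebra with a ${\bf k}$-bilinear bracket $\{-,-\}$ making it a Lie algebra and such that each $H_a:=\{a,-\}$ is a derivation. A Poisson double extension of a Poisson algebra $R$ with variables $y_1,y_2$ and PDE-data $\{q,\alpha,\nu,w\}$, where $q=\{q_{11},q_{12}\}\subset{\bf k}$, $w=\{w_1,w_2,w_0\}\subset R$, $\alpha=(\alpha_{ij}):R\to M_{2\times 2}(R)$ and $\nu=(\nu_1,\nu_2)^T:R\to M_{2\times1}(R)$ are ${\bf k}$-linear, is the commutative polynomial ring $R[y_1,y_2]$ endowed with a Poisson bracket that restricts to the given bracket on $R$ and satisfies $\{y_2,y_1\}=q_{11}y_1^2+q_{12}y_1y_2+w_1y_1+w_2y_2+w_0$ and $\{y_i,a\}=\alpha_{i1}(a)y_1+\alpha_{i2}(a)y_2+\nu_i(a)$ for $i=1,2$ and $a\in R$. (Then the $\alpha_{ij}$ and $\nu_i$ are derivations of $R$.) For a smooth algebra $B$ of Krull dimension $m$ with trivial canonical bundle $\Omega^m(B)=B\,\mathrm{vol}$ (free of rank one on the volume form $\mathrm{vol}$; $\Omega^*(B)$ is the algebra of Kähler differential forms over ${\bf k}$) and a derivation $D$ of $B$, let $\iota_D$ be the contraction and $\mathscr{L}_D:=[d,\iota_D]=d\iota_D+\iota_Dd$ the Lie derivative on $\Omega^*(B)$. If $B$ is Poisson, the modular derivation of $B$ with respect to $\mathrm{vol}$ is the map $\phi_{\mathrm{vol}}:B\to B$, $\phi_{\mathrm{vol}}(f)=\mathscr{L}_{H_f}(\mathrm{vol})/\mathrm{vol}$.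 *)

theory Defs
  imports
    "HOL-Computational_Algebra.Polynomial"
    "HOL-Library.Poly_Mapping"
    "HOL-Library.Extended_Nat"
begin

section \<open>Commutative algebras over a field of characteristic zero\<close>

text \<open>
  A nonzero commutative algebra over a field \<open>k\<close> of characteristic zero is a commutative ring
  together with the subfield \<open>k \<cdot> 1\<close>; the class carries that subfield as the parameter
  \<open>scalars\<close>, so that types depending on the ground field (such as Kaehler forms) can be built.
\<close>

class char0_algebra = comm_ring_1 + ring_char_0 +
  fixes scalars :: "'a set"
  assumes one_in_scalars: "1 \<in> scalars"
    and diff_in_scalars: "c \<in> scalars \<Longrightarrow> c' \<in> scalars \<Longrightarrow> c - c' \<in> scalars"
    and mult_in_scalars: "c \<in> scalars \<Longrightarrow> c' \<in> scalars \<Longrightarrow> c * c' \<in> scalars"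
    and inverse_in_scalars: "c \<in> scalars \<Longrightarrow> c \<noteq> 0 \<Longrightarrow> \<exists>c'\<in>scalars. c * c' = 1"

instantiation poly :: (char0_algebra) char0_algebra
begin

definition scalars_poly :: "'a poly set" where
  "scalars_poly = (\<lambda>c. [:c:]) ` scalars"

instance
proof
  show "(1 :: 'a poly) \<in> scalars"
    unfolding scalars_poly_def one_pCons using one_in_scalars by blast
next
  fix c c' :: "'a poly"
  assume "c \<in> scalars" "c' \<in> scalars"
  then obtain a b where ab: "a \<in> scalars" "b \<in> scalars" "c = [:a:]" "c' = [:b:]"
    unfolding scalars_poly_def by blast
  show "c - c' \<in> scalars" "c * c' \<in> scalars"
    using diff_in_scalars[OF ab(1,2)] mult_in_scalars[OF ab(1,2)]
    by (auto simp: scalars_poly_def ab(3,4) mult.commute)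
next
  fix c :: "'a poly"
  assume "c \<in> scalars" "c \<noteq> 0"
  then obtain a where a: "a \<in> scalars" "a \<noteq> 0" "c = [:a:]"
    unfolding scalars_poly_def by auto
  with inverse_in_scalars[of a] obtain b where "b \<in> scalars" "a * b = 1" by blast
  then show "\<exists>c'\<in>scalars. c * c' = 1"
    by (auto simp: scalars_poly_def a(3) one_pCons)
qed

end

definition k_linear :: "('a::char0_algebra \<Rightarrow> 'a) \<Rightarrow> bool" where
  "k_linear f \<longleftrightarrow>
    (\<forall>a b. f (a + b) = f a + f b) \<and> (\<forall>c\<in>scalars. \<forall>a. f (c * a) = c * f a)"

definition derivation :: "('a::char0_algebra \<Rightarrow> 'a) \<Rightarrow> bool" where
  "derivation D \<longleftrightarrow> k_linear D \<and> (\<forall>a b. D (a * b) = a * D b + b * D a)"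

inductive_set subalgebra_generated :: "'a::char0_algebra set \<Rightarrow> 'a set" for G where
  scalar: "c \<in> scalars \<Longrightarrow> c \<in> subalgebra_generated G"
| generator: "g \<in> G \<Longrightarrow> g \<in> subalgebra_generated G"
| add: "a \<in> subalgebra_generated G \<Longrightarrow> b \<in> subalgebra_generated G \<Longrightarrow>
    a + b \<in> subalgebra_generated G"
| mult: "a \<in> subalgebra_generated G \<Longrightarrow> b \<in> subalgebra_generated G \<Longrightarrow>
    a * b \<in> subalgebra_generated G"

definition affine_algebra :: "'a::char0_algebra itself \<Rightarrow> bool" where
  "affine_algebra _ \<longleftrightarrow> (\<exists>G::'a set. finite G \<and> subalgebra_generated G = UNIV)"


section \<open>Krull dimension\<close>

definition prime_ideal :: "'a::comm_ring_1 set \<Rightarrow> bool" where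
  "prime_ideal P \<longleftrightarrow>
    0 \<in> P \<and> (\<forall>a\<in>P. \<forall>b\<in>P. a + b \<in> P) \<and> (\<forall>a\<in>P. \<forall>b. b * a \<in> P) \<and>
    1 \<notin> P \<and> (\<forall>a b. a * b \<in> P \<longrightarrow> a \<in> P \<or> b \<in> P)"

text \<open>The Krull dimension of the quotient by \<open>Q\<close>: chains of primes of \<open>B/Q\<close> are chains of
  primes of \<open>B\<close> above \<open>Q\<close>.\<close>

definition quotient_dim :: "'a::comm_ring_1 set \<Rightarrow> enat" where
  "quotient_dim Q = Sup {enat m |m. \<exists>P :: nat \<Rightarrow> 'a set.
     (\<forall>i\<le>m. prime_ideal (P i) \<and> Q \<subseteq> P i) \<and> (\<forall>i<m. P i \<subset> P (Suc i))}"

definition krull_dim :: "'a::comm_ring_1 itself \<Rightarrow> enat" where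
  "krull_dim _ = quotient_dim ({0} :: 'a set)"

text \<open>For an affine algebra, the dimension of the spectrum at the point \<open>P\<close>: the largest dimension
  of an irreducible component through \<open>P\<close>.\<close>

definition local_dim :: "'a::comm_ring_1 set \<Rightarrow> enat" where
  "local_dim P = Sup (quotient_dim ` {Q. prime_ideal Q \<and> Q \<subseteq> P})"


section \<open>The algebra of Kaehler differential forms\<close>

text \<open>
  Lists form the free monoid, so \<open>'a list \<Rightarrow>\<^sub>0 'a\<close> is the tensor algebra (over \<open>'a\<close>) of the free
  \<open>'a\<close>-module on the symbols \<open>\<delta> b\<close>; the word \<open>[b\<^sub>1, \<dots>, b\<^sub>p]\<close> stands for
  \<open>\<delta> b\<^sub>1 \<otimes> \<dots> \<otimes> \<delta> b\<^sub>p\<close>.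
\<close>

instantiation list :: (type) monoid_add
begin
definition zero_list :: "'a list" where "zero_list = []"
definition plus_list :: "'a list \<Rightarrow> 'a list \<Rightarrow> 'a list" where "plus_list = (@)"
instance by standard (simp_all add: zero_list_def plus_list_def)
end

abbreviation tensor :: "'a \<Rightarrow> 'a list \<Rightarrow> 'a list \<Rightarrow>\<^sub>0 'a::char0_algebra" where
  "tensor b xs \<equiv> Poly_Mapping.single xs b"

text \<open>
  The first three kinds of relators present the module of Kaehler differentials; the squares then
  present its exterior algebra. It is enough to take squares of the symbols \<open>\<delta> a\<close>, because the
  square of \<open>\<delta> (a + b)\<close> gives the anticommutativity of \<open>\<delta> a\<close> and \<open>\<delta> b\<close>.
\<close>

inductive_set form_relators :: "('a list \<Rightarrow>\<^sub>0 'a::char0_algebra) set" where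
  additive: "tensor 1 [a + b] - tensor 1 [a] - tensor 1 [b] \<in> form_relators"
| leibniz: "tensor 1 [a * b] - tensor a [b] - tensor b [a] \<in> form_relators"
| scalar: "c \<in> scalars \<Longrightarrow> tensor 1 [c] \<in> form_relators"
| square: "tensor 1 [a, a] \<in> form_relators"

text \<open>The two-sided ideal generated by the relators.\<close>

inductive_set form_ideal :: "('a list \<Rightarrow>\<^sub>0 'a::char0_algebra) set" where
  zero: "0 \<in> form_ideal"
| add: "u \<in> form_ideal \<Longrightarrow> v \<in> form_ideal \<Longrightarrow> u + v \<in> form_ideal"
| multiple: "r \<in> form_relators \<Longrightarrow> u * r * v \<in> form_ideal"

lemma form_ideal_uminus: "u \<in> form_ideal \<Longrightarrow> - u \<in> form_ideal"
proof (induction rule: form_ideal.induct)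
  case (multiple r u v)
  from form_ideal.multiple[OF this, of "- u" v] show ?case by simp
next
  case (add u v)
  from form_ideal.add[OF add.IH] show ?case by simp
qed (simp add: form_ideal.zero)

lemma form_ideal_diff: "u \<in> form_ideal \<Longrightarrow> v \<in> form_ideal \<Longrightarrow> u - v \<in> form_ideal"
  using form_ideal.add form_ideal_uminus by fastforce

lemma form_ideal_mult:
  "u \<in> form_ideal \<Longrightarrow> w * u \<in> form_ideal"
  "u \<in> form_ideal \<Longrightarrow> u * w \<in> form_ideal"
proof (induction rule: form_ideal.induct)
  case (multiple r u v)
  { case 1 show ?case
      using form_ideal.multiple[OF multiple, of "w * u" v] by (simp add: mult.assoc) }
  { case 2 show ?case
      using form_ideal.multiple[OF multiple, of u "v * w"] by (simp add: mult.assoc) }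
qed (auto intro: form_ideal.zero form_ideal.add simp: distrib_left distrib_right)

definition form_rel :: "('a list \<Rightarrow>\<^sub>0 'a::char0_algebra) \<Rightarrow> ('a list \<Rightarrow>\<^sub>0 'a) \<Rightarrow> bool" where
  "form_rel u v \<longleftrightarrow> u - v \<in> form_ideal"

lemma equivp_form_rel: "equivp form_rel"
proof (intro equivpI reflpI sympI transpI)
  fix u v w :: "'a list \<Rightarrow>\<^sub>0 'a"
  show "form_rel u u"
    by (simp add: form_rel_def form_ideal.zero)
  show "form_rel v u" if "form_rel u v"
    using form_ideal_uminus[OF that[unfolded form_rel_def]] by (simp add: form_rel_def)
  show "form_rel u w" if "form_rel u v" "form_rel v w"
    using form_ideal.add[OF that[unfolded form_rel_def]] by (simp add: form_rel_def)
qed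

quotient_type (overloaded) 'a form = "'a::char0_algebra list \<Rightarrow>\<^sub>0 'a" / form_rel
  morphisms rep_form form_class
  by (rule equivp_form_rel)

instantiation form :: (char0_algebra) ring
begin

lift_definition zero_form :: "'a form" is 0 .

lift_definition plus_form :: "'a form \<Rightarrow> 'a form \<Rightarrow> 'a form" is "(+)"
  unfolding form_rel_def by (subst add_diff_add) (rule form_ideal.add)

lift_definition uminus_form :: "'a form \<Rightarrow> 'a form" is uminus
  unfolding form_rel_def by (subst minus_diff_minus) (rule form_ideal_uminus)

lift_definition minus_form :: "'a form \<Rightarrow> 'a form \<Rightarrow> 'a form" is "(-)"
proof -
  fix u u' v v' :: "'a list \<Rightarrow>\<^sub>0 'a"
  assume "form_rel u u'" "form_rel v v'"
  moreover have "u - v - (u' - v') = (u - u') - (v - v')"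
    by simp
  ultimately show "form_rel (u - v) (u' - v')"
    unfolding form_rel_def by (simp only: form_ideal_diff)
qed

lift_definition times_form :: "'a form \<Rightarrow> 'a form \<Rightarrow> 'a form" is "(*)"
proof -
  fix u u' v v' :: "'a list \<Rightarrow>\<^sub>0 'a"
  assume "form_rel u u'" "form_rel v v'"
  moreover have "u * v - u' * v' = u * (v - v') + (u - u') * v'"
    by (simp add: algebra_simps)
  ultimately show "form_rel (u * v) (u' * v')"
    unfolding form_rel_def by (auto intro: form_ideal.add form_ideal_mult)
qed

instance
  by standard (transfer, simp add: form_rel_def form_ideal.zero algebra_simps)+

end

text \<open>The product of forms is the wedge product; \<open>fun_form\<close> embeds the functions as 0-forms.\<close>

abbreviation (input) wedge :: "'a::char0_algebra form \<Rightarrow> 'a form \<Rightarrow> 'a form" (infixl "\<and>\<^sub>\<Omega>" 70) where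
  "\<omega> \<and>\<^sub>\<Omega> \<eta> \<equiv> \<omega> * \<eta>"

lift_definition fun_form :: "'a::char0_algebra \<Rightarrow> 'a form" is "\<lambda>b. tensor b []" .

abbreviation scale_form :: "'a::char0_algebra \<Rightarrow> 'a form \<Rightarrow> 'a form" (infixr "*\<^sub>\<Omega>" 75) where
  "b *\<^sub>\<Omega> \<omega> \<equiv> fun_form b * \<omega>"

definition forms_of_degree :: "nat \<Rightarrow> 'a::char0_algebra form set" where
  "forms_of_degree p = form_class ` {w. \<forall>xs\<in>Poly_Mapping.keys w. length xs = p}"

definition volume_form :: "nat \<Rightarrow> 'a::char0_algebra form \<Rightarrow> bool" where
  "volume_form n vol \<longleftrightarrow>
    vol \<in> forms_of_degree n \<and> (\<forall>\<omega>\<in>forms_of_degree n. \<exists>!b. \<omega> = b *\<^sub>\<Omega> vol)"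


subsection \<open>Additive maps on the tensor algebra and well-definedness\<close>

lemma list_monoid_simps: "xs + ys = xs @ ys" "(0 :: 'a list) = []"
  by (simp_all add: plus_list_def zero_list_def)

definition extend :: "('a list \<Rightarrow> 'a \<Rightarrow> 'b) \<Rightarrow> ('a list \<Rightarrow>\<^sub>0 'a::char0_algebra) \<Rightarrow> 'b::ab_group_add"
  where "extend g w = (\<Sum>xs\<in>Poly_Mapping.keys w. g xs (Poly_Mapping.lookup w xs))"

lemma additive_0:
  fixes g :: "'a::ab_group_add \<Rightarrow> 'b::ab_group_add"
  assumes "\<And>a b. g (a + b) = g a + g b"
  shows "g 0 = 0"
  using assms[of 0 0] by simp

lemma extend_add:
  assumes "\<And>xs a b. g xs (a + b) = g xs a + g xs b"
  shows "extend g (u + v) = extend g u + extend g v"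
  unfolding extend_def
  by (rule setsum_keys_plus_distrib) (simp_all only: assms additive_0[of "g _", OF assms])

lemma extend_single:
  assumes "\<And>xs a b. g xs (a + b) = g xs a + g xs b"
  shows "extend g (tensor b xs) = g xs b"
  unfolding extend_def by (simp add: additive_0[of "g _", OF assms])

lemma tensor_induct [case_names zero single add]:
  assumes "P 0" "\<And>xs b. P (tensor b xs)" "\<And>u v. P u \<Longrightarrow> P v \<Longrightarrow> P (u + v)"
  shows "P (w :: 'a list \<Rightarrow>\<^sub>0 'a::char0_algebra)"
proof -
  have "P (\<Sum>xs\<in>A. tensor (Poly_Mapping.lookup w xs) xs)" if "finite A" for A
    using that by induction (simp_all add: assms)
  moreover have "w = (\<Sum>xs\<in>Poly_Mapping.keys w. tensor (Poly_Mapping.lookup w xs) xs)"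
    by (rule poly_mapping_eqI)
      (simp add: lookup_sum lookup_single when_def in_keys_iff)
  ultimately show ?thesis by (metis finite_keys)
qed

lemma additive_vanishes_on_ideal:
  fixes F :: "('a list \<Rightarrow>\<^sub>0 'a::char0_algebra) \<Rightarrow> 'b::ab_group_add"
  assumes add: "\<And>u v. F (u + v) = F u + F v"
    and rel: "\<And>r xs b ys c. r \<in> form_relators \<Longrightarrow> F (tensor b xs * r * tensor c ys) = 0"
    and w: "w \<in> form_ideal"
  shows "F w = 0"
  using w
proof (induction rule: form_ideal.induct)
  case zero show ?case using additive_0[OF add] .
next
  case (add u v) then show ?case by (simp add: assms(1))
next
  case (multiple r u v)
  have *: "F (tensor b xs * r * v) = 0" for b xs
    by (induction v rule: tensor_induct)
      (simp_all add: rel multiple additive_0[OF add] assms(1) distrib_left)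
  show ?case
    by (induction u rule: tensor_induct)
      (simp_all add: * additive_0[OF add] assms(1) distrib_right)
qed

lemma additive_respects_form_rel:
  fixes F :: "('a list \<Rightarrow>\<^sub>0 'a::char0_algebra) \<Rightarrow> 'b::ab_group_add"
  assumes "\<And>u v. F (u + v) = F u + F v"
    and "\<And>r xs b ys c. r \<in> form_relators \<Longrightarrow> F (tensor b xs * r * tensor c ys) = 0"
    and "form_rel u v"
  shows "F u = F v"
proof -
  have "F (u - v) = 0"
    using additive_vanishes_on_ideal[of F, OF assms(1,2)] assms(3) by (simp add: form_rel_def)
  then show ?thesis using assms(1)[of "u - v" v] by simp
qed

lift_definition word_form :: "'a::char0_algebra list \<Rightarrow> 'a form" is "\<lambda>xs. tensor 1 xs" .

lemma form_class_eq_iff: "form_class u = form_class v \<longleftrightarrow> form_rel u v"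
  by (rule form.abs_eq_iff)

lemma form_class_hom:
  "form_class (u + v) = form_class u + form_class v"
  "form_class (u - v) = form_class u - form_class v"
  "form_class (- u) = - form_class u"
  "form_class (u * v) = form_class u * form_class v"
  "form_class 0 = 0"
  by (simp_all add: plus_form.abs_eq minus_form.abs_eq uminus_form.abs_eq times_form.abs_eq
      zero_form.abs_eq)

lemma form_class_sum: "form_class (sum f A) = (\<Sum>x\<in>A. form_class (f x))"
  by (induction A rule: infinite_finite_induct) (simp_all add: form_class_hom)

lemma form_class_tensor: "form_class (tensor b xs) = fun_form b * word_form xs"
  by (simp add: fun_form.abs_eq word_form.abs_eq times_form.abs_eq[symmetric]
      form_class_hom(4)[symmetric] mult_single list_monoid_simps)

lemma fun_form_add: "fun_form (a + b) = fun_form a + fun_form b"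
  by (simp add: fun_form.abs_eq form_class_hom(1)[symmetric] single_add)

lemma fun_form_mult: "fun_form (a * b) = fun_form a * fun_form b"
  by (simp add: fun_form.abs_eq form_class_hom(4)[symmetric] mult_single list_monoid_simps)

lemma fun_form_0 [simp]: "fun_form 0 = 0"
  by (simp add: fun_form.abs_eq form_class_hom)

lemma fun_form_uminus: "fun_form (- a) = - fun_form a"
  by (simp add: fun_form.abs_eq form_class_hom(3)[symmetric] single_uminus)

lemma fun_form_diff: "fun_form (a - b) = fun_form a - fun_form b"
  using fun_form_add[of a "- b"] by (simp add: fun_form_uminus)

lemma word_form_Nil [simp]: "word_form [] * \<omega> = \<omega>" "\<omega> * word_form [] = \<omega>"
  "fun_form 1 = word_form []"
  by (transfer, simp add: list_monoid_simps(2)[symmetric] form_rel_def form_ideal.zero single_one)+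

lemma word_form_append: "word_form (xs @ ys) = word_form xs * word_form ys"
  by (simp add: word_form.abs_eq form_class_hom(4)[symmetric] mult_single list_monoid_simps)

lemma word_form_Cons: "word_form (x # xs) = word_form [x] * word_form xs"
  using word_form_append[of "[x]" xs] by simp

lemma fun_form_commute: "\<omega> * fun_form b = fun_form b * \<omega>"
proof transfer
  fix w :: "'a list \<Rightarrow>\<^sub>0 'a" and b
  have "w * tensor b [] = tensor b [] * w"
    by (induction w rule: tensor_induct)
      (simp_all add: mult_single list_monoid_simps distrib_left distrib_right mult.commute)
  then show "form_rel (w * tensor b []) (tensor b [] * w)"
    by (simp add: form_rel_def form_ideal.zero)
qed

lemma form_class_relator: "r \<in> form_relators \<Longrightarrow> form_class r = 0"
  using form_ideal.multiple[of r 1 1] by (simp add: zero_form.abs_eq form_class_eq_iff form_rel_def)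

lemma delta_add: "word_form [a + b] = word_form [a] + word_form [b]"
  using form_class_relator[OF form_relators.additive[of a b]]
  by (simp add: form_class_hom word_form.abs_eq[symmetric] algebra_simps)

lemma delta_mult: "word_form [a * b] = fun_form a * word_form [b] + fun_form b * word_form [a]"
  using form_class_relator[OF form_relators.leibniz[of a b]]
  by (simp add: form_class_hom form_class_tensor algebra_simps)

lemma delta_scalar: "c \<in> scalars \<Longrightarrow> word_form [c] = 0"
  using form_class_relator[OF form_relators.scalar[of c]] by (simp add: word_form.abs_eq)

lemma delta_square: "word_form [a] * word_form [a] = 0"
  using form_class_relator[OF form_relators.square[of a]]
  by (simp add: word_form_append[symmetric] word_form.abs_eq[symmetric])

lemma delta_anticommute: "word_form [a] * word_form [b] = - (word_form [b] * word_form [a])"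
proof -
  have "0 = word_form [a + b] * word_form [a + b]" by (simp add: delta_square)
  also have "\<dots> = word_form [a] * word_form [b] + word_form [b] * word_form [a]"
    unfolding delta_add by (simp add: distrib_left distrib_right delta_square)
  finally show ?thesis by (simp add: eq_neg_iff_add_eq_0)
qed

lemma delta_word_commute:
  "word_form [a] * word_form xs =
     (if even (length xs) then word_form xs * word_form [a] else - (word_form xs * word_form [a]))"
proof (induction xs)
  case (Cons x xs)
  have "word_form [a] * word_form (x # xs) = - (word_form [x] * (word_form [a] * word_form xs))"
    by (subst word_form_Cons) (simp add: mult.assoc[symmetric] delta_anticommute[of a x])
  then show ?case
    unfolding Cons word_form_Cons[of x xs] by (simp add: mult.assoc)
qed simp

lemma delta_swap:
  "word_form [a] * word_form xs * word_form [b] = - (word_form [b] * word_form xs * word_form [a])"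
proof -
  have "word_form [a] * word_form xs * word_form [b] =
      (if even (length xs) then word_form xs * (word_form [a] * word_form [b])
       else - (word_form xs * (word_form [a] * word_form [b])))"
    by (simp add: delta_word_commute[of a xs] mult.assoc)
  also have "\<dots> = - (word_form [b] * word_form xs * word_form [a])"
    by (simp add: delta_word_commute[of b xs] mult.assoc delta_anticommute[of a b])
  finally show ?thesis .
qed


subsection \<open>Exterior derivative, contraction and Lie derivative\<close>

lemma form_class_extend: "form_class (extend g w) = extend (\<lambda>xs b. form_class (g xs b)) w"
  by (simp add: extend_def form_class_sum)

lemma extend_respects_form_rel:
  fixes g :: "'a::char0_algebra list \<Rightarrow> 'a \<Rightarrow> 'b::ab_group_add"
  assumes add: "\<And>xs a b. g xs (a + b) = g xs a + g xs b"
    and additive: "\<And>xs f a b ys.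
      g (xs @ [a + b] @ ys) f = g (xs @ [a] @ ys) f + g (xs @ [b] @ ys) f"
    and leibniz: "\<And>xs f a b ys.
      g (xs @ [a * b] @ ys) f = g (xs @ [b] @ ys) (f * a) + g (xs @ [a] @ ys) (f * b)"
    and scalar: "\<And>xs f c ys. c \<in> scalars \<Longrightarrow> g (xs @ [c] @ ys) f = 0"
    and square: "\<And>xs f a ys. g (xs @ [a, a] @ ys) f = 0"
    and rel: "form_rel u v"
  shows "extend g u = extend g v"
proof (rule additive_respects_form_rel[OF extend_add[OF add] _ rel])
  have diff: "extend g (u - v) = extend g u - extend g v" for u v
    using extend_add[of g "u - v" v, OF add] by simp
  note single = extend_single[of g, OF add]
  fix r :: "'a list \<Rightarrow>\<^sub>0 'a" and xs b ys c
  assume "r \<in> form_relators"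
  then show "extend g (tensor b xs * r * tensor c ys) = 0"
  proof cases
    case (additive a a')
    then show ?thesis
      using assms(2)[of xs a a' ys "b * c"]
      by (simp add: left_diff_distrib right_diff_distrib diff mult_single list_monoid_simps single)
  next
    case (leibniz a a')
    then show ?thesis
      using assms(3)[of xs a a' ys "b * c"]
      by (simp add: left_diff_distrib right_diff_distrib diff mult_single list_monoid_simps single
          ac_simps)
  next
    case (scalar a)
    then show ?thesis
      using assms(4)[of a xs ys "b * c"] by (simp add: mult_single list_monoid_simps single)
  next
    case (square a)
    then show ?thesis
      using assms(5)[of xs a ys "b * c"] by (simp add: mult_single list_monoid_simps single)
  qed
qed

lemmas word_form_split = word_form_append[of _ "[_] @ _"] word_form_append[of "[_]"]

lemma fun_form_left_commute: "\<omega> * (fun_form b * \<eta>) = fun_form b * (\<omega> * \<eta>)"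
  by (simp add: mult.assoc[symmetric] fun_form_commute)

text \<open>\<open>d (b db\<^sub>1 \<and> \<dots> \<and> db\<^sub>p) = db \<and> db\<^sub>1 \<and> \<dots> \<and> db\<^sub>p\<close>\<close>

lift_definition ext_d :: "'a::char0_algebra form \<Rightarrow> 'a form" is
  "extend (\<lambda>xs b. tensor 1 (b # xs))"
proof -
  fix u v :: "'a list \<Rightarrow>\<^sub>0 'a"
  assume rel: "form_rel u v"
  let ?g = "\<lambda>xs b. word_form [b] * word_form xs"
  have "extend ?g u = extend ?g v"
  proof (rule extend_respects_form_rel[OF _ _ _ _ _ rel])
    fix xs ys :: "'a list" and f a b :: 'a
    show "word_form [f] * word_form (xs @ [a * b] @ ys) =
        word_form [f * a] * word_form (xs @ [b] @ ys) +
        word_form [f * b] * word_form (xs @ [a] @ ys)"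
      using arg_cong[OF delta_swap[of a xs b], of "\<lambda>\<omega>. fun_form f * (\<omega> * word_form ys)"]
      unfolding word_form_split delta_mult
      by (simp add: distrib_left distrib_right mult.assoc fun_form_left_commute[of "word_form _"])
  next
    fix xs ys :: "'a list" and f a :: 'a
    have "word_form ([a, a] @ ys) = 0"
      using delta_square[of a]
      by (simp add: word_form_Cons[of a "_ # _"] word_form_Cons[of a ys] mult.assoc[symmetric])
    then show "word_form [f] * word_form (xs @ [a, a] @ ys) = 0"
      unfolding word_form_append[of xs] by simp
  qed (simp_all only: word_form_split delta_add delta_scalar distrib_left distrib_right
      mult_zero_left mult_zero_right)
  then show "form_rel (extend (\<lambda>xs b. tensor 1 (b # xs)) u)
      (extend (\<lambda>xs b. tensor 1 (b # xs)) v)"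
    by (simp add: form_class_eq_iff[symmetric] form_class_extend word_form.abs_eq[symmetric]
        word_form_Cons[symmetric])
qed

text \<open>\<open>\<iota>\<^sub>D (db\<^sub>1 \<and> \<dots> \<and> db\<^sub>p) = D b\<^sub>1 db\<^sub>2 \<and> \<dots> \<and> db\<^sub>p - db\<^sub>1 \<and> \<iota>\<^sub>D (db\<^sub>2 \<and> \<dots> \<and> db\<^sub>p)\<close>\<close>

fun contract_word :: "('a \<Rightarrow> 'a) \<Rightarrow> 'a list \<Rightarrow> 'a list \<Rightarrow>\<^sub>0 'a::char0_algebra" where
  "contract_word D [] = 0"
| "contract_word D (x # xs) = tensor (D x) xs - tensor 1 [x] * contract_word D xs"

lemma form_class_contract_word:
  "form_class (contract_word D []) = 0"
  "form_class (contract_word D (x # xs)) =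
     fun_form (D x) * word_form xs - word_form [x] * form_class (contract_word D xs)"
  by (simp_all add: form_class_hom form_class_tensor)

lemma contract_word_append:
  "form_class (contract_word D (xs @ ys)) =
     form_class (contract_word D xs) * word_form ys +
     (if even (length xs) then word_form xs * form_class (contract_word D ys)
      else - (word_form xs * form_class (contract_word D ys)))"
proof (induction xs)
  case (Cons x xs)
  show ?case
    unfolding append_Cons form_class_contract_word Cons word_form_append word_form_Cons[of x xs]
    by (simp add: algebra_simps)
qed (simp add: form_class_contract_word del: contract_word.simps)

text \<open>Contraction is only well-defined on forms for a derivation; it is set to 0 otherwise.\<close>

lift_definition contraction :: "('a::char0_algebra \<Rightarrow> 'a) \<Rightarrow> 'a form \<Rightarrow> 'a form" is
  "\<lambda>D. if derivation D then extend (\<lambda>xs b. tensor b [] * contract_word D xs) else (\<lambda>_. 0)"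
proof -
  fix D :: "'a \<Rightarrow> 'a" and u v :: "'a list \<Rightarrow>\<^sub>0 'a"
  assume rel: "form_rel u v"
  let ?c = "\<lambda>xs. form_class (contract_word D xs)"
  let ?g = "\<lambda>xs b. fun_form b * ?c xs"
  show "form_rel
      ((if derivation D then extend (\<lambda>xs b. tensor b [] * contract_word D xs) else (\<lambda>_. 0)) u)
      ((if derivation D then extend (\<lambda>xs b. tensor b [] * contract_word D xs) else (\<lambda>_. 0)) v)"
  proof (cases "derivation D")
    case True
    then have D: "D (a + b) = D a + D b" "D (a * b) = a * D b + b * D a" for a b
      by (simp_all add: derivation_def k_linear_def)
    have "D 1 = 0" using D(2)[of 1 1] by simp
    then have D_scalar: "D c = 0" if "c \<in> scalars" for c
      using True that unfolding derivation_def k_linear_def by (metis mult.right_neutral mult_zero_right)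
    define T where "T xs ys p q =
      ?c xs * (p * word_form ys) +
      (if even (length xs) then word_form xs * (q * word_form ys - p * ?c ys)
       else - (word_form xs * (q * word_form ys - p * ?c ys)))" for xs ys p q
    have c: "?c (xs @ [z] @ ys) = T xs ys (word_form [z]) (fun_form (D z))" for xs z ys
      unfolding T_def contract_word_append[of D xs]
      by (simp add: form_class_contract_word word_form_Cons[of z ys] del: contract_word.simps)
    have T_add: "T xs ys (p + p') (q + q') = T xs ys p q + T xs ys p' q'" for xs ys p p' q q'
      by (simp add: T_def algebra_simps)
    have T_scale: "T xs ys (fun_form a * p) (fun_form a * q) = fun_form a * T xs ys p q"
      for xs ys a p q
      by (simp add: T_def mult.assoc fun_form_left_commute[of "word_form _"]
          fun_form_left_commute[of "form_class _"] algebra_simps)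
    have "extend ?g u = extend ?g v"
    proof (rule extend_respects_form_rel[OF _ _ _ _ _ rel])
      fix xs ys :: "'a list" and f a b :: 'a
      show "fun_form f * ?c (xs @ [a + b] @ ys) =
          fun_form f * ?c (xs @ [a] @ ys) + fun_form f * ?c (xs @ [b] @ ys)"
        unfolding c D delta_add fun_form_add T_add by (simp add: distrib_left)
      show "fun_form f * ?c (xs @ [a * b] @ ys) =
          fun_form (f * a) * ?c (xs @ [b] @ ys) + fun_form (f * b) * ?c (xs @ [a] @ ys)"
        unfolding c D delta_mult fun_form_add T_add fun_form_mult T_scale
        by (simp add: distrib_left mult.assoc)
    next
      fix xs ys :: "'a list" and f c :: 'a
      assume "c \<in> scalars"
      then show "fun_form f * ?c (xs @ [c] @ ys) = 0"
        unfolding c by (simp add: D_scalar delta_scalar T_def)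
    next
      fix xs ys :: "'a list" and f a :: 'a
      have "?c ([a, a] @ ys) = fun_form (D a) * (word_form [a] * word_form ys) -
          (fun_form (D a) * (word_form [a] * word_form ys) - word_form [a] * word_form [a] * ?c ys)"
        by (simp add: form_class_contract_word word_form_Cons[of a ys] right_diff_distrib
            fun_form_left_commute[of "word_form [a]"] mult.assoc del: contract_word.simps)
      also have "\<dots> = 0"
        by (simp add: delta_square)
      finally have "?c ([a, a] @ ys) = 0" .
      moreover have "word_form ([a, a] @ ys) = 0"
        using delta_square[of a]
        by (simp add: word_form_Cons[of a "_ # _"] word_form_Cons[of a ys] mult.assoc[symmetric])
      ultimately show "fun_form f * ?c (xs @ [a, a] @ ys) = 0"
        unfolding contract_word_append[of D xs] by simp
    qed (simp add: fun_form_add distrib_right)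
    with True show ?thesis
      by (simp add: form_class_eq_iff[symmetric] form_class_extend form_class_hom
          fun_form.abs_eq[symmetric])
  qed (simp add: form_rel_def form_ideal.zero)
qed

definition lie_derivative :: "('a::char0_algebra \<Rightarrow> 'a) \<Rightarrow> 'a form \<Rightarrow> 'a form" where
  "lie_derivative D \<omega> = ext_d (contraction D \<omega>) + contraction D (ext_d \<omega>)"


section \<open>Smooth affine algebras\<close>

text \<open>The submodule \<open>P \<Omega>\<^sup>1\<close> of the module of Kaehler differentials.\<close>

definition ideal_times_forms :: "'a::char0_algebra set \<Rightarrow> 'a form set" where
  "ideal_times_forms P = {\<Sum>i<(m::nat). p i *\<^sub>\<Omega> \<eta> i |m p \<eta>.
     \<forall>i<m. p i \<in> P \<and> \<eta> i \<in> forms_of_degree 1}"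

text \<open>
  The dimension of \<open>\<Omega>\<^sup>1 \<otimes> \<kappa>(P)\<close> over the residue field \<open>\<kappa>(P)\<close>, the fraction field of \<open>B/P\<close>.
  Up to units of \<open>\<kappa>(P)\<close> every vector comes from \<open>\<Omega>\<^sup>1\<close> and every coefficient tuple from \<open>B\<close>, and
  the image of a differential \<open>\<omega>\<close> vanishes iff \<open>s \<omega> \<in> P \<Omega>\<^sup>1\<close> for some \<open>s \<notin> P\<close>; so the condition
  below is linear independence of the images of \<open>\<omega> 0, \<dots>, \<omega> (m - 1)\<close>.
\<close>

definition fibre_dim :: "'a::char0_algebra set \<Rightarrow> enat" where
  "fibre_dim P = Sup {enat m |m. \<exists>\<omega> :: nat \<Rightarrow> 'a form.
     (\<forall>i<m. \<omega> i \<in> forms_of_degree 1) \<and>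
     (\<forall>b s. s \<notin> P \<longrightarrow> s *\<^sub>\<Omega> (\<Sum>i<m. b i *\<^sub>\<Omega> \<omega> i) \<in> ideal_times_forms P \<longrightarrow> (\<forall>i<m. b i \<in> P))}"

text \<open>
  Smoothness over a field (where flatness is automatic): finite type, and at every point the fibre
  of \<open>\<Omega>\<^sup>1\<close> has the dimension of the spectrum at that point (Hartshorne, Section III.10, with the
  relative dimension allowed to vary between components).
\<close>

definition smooth_affine_algebra :: "'a::char0_algebra itself \<Rightarrow> bool" where
  "smooth_affine_algebra B \<longleftrightarrow>
    affine_algebra B \<and> (\<forall>P :: 'a set. prime_ideal P \<longrightarrow> fibre_dim P = local_dim P)"


section \<open>Poisson algebras and the modular derivation\<close>

definition poisson_bracket :: "('a::char0_algebra \<Rightarrow> 'a \<Rightarrow> 'a) \<Rightarrow> bool" where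
  "poisson_bracket br \<longleftrightarrow>
    (\<forall>a. k_linear (br a)) \<and> (\<forall>b. k_linear (\<lambda>a. br a b)) \<and>
    (\<forall>a. br a a = 0) \<and>
    (\<forall>a b c. br a (br b c) + br b (br c a) + br c (br a b) = 0) \<and>
    (\<forall>a. derivation (br a))"

text \<open>\<open>br f\<close> is the Hamiltonian derivation of \<open>f\<close>; the quotient of two top forms is the unique
  coefficient.\<close>

definition modular_derivation ::
    "('a::char0_algebra \<Rightarrow> 'a \<Rightarrow> 'a) \<Rightarrow> 'a form \<Rightarrow> 'a \<Rightarrow> 'a" where
  "modular_derivation br vol f = (THE g. lie_derivative (br f) vol = g *\<^sub>\<Omega> vol)"


section \<open>Poisson double extensions\<close>

text \<open>\<open>R[y\<^sub>1, y\<^sub>2]\<close> is represented as \<open>R[y\<^sub>1][y\<^sub>2]\<close>.\<close>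

definition const :: "'a::comm_ring_1 \<Rightarrow> 'a poly poly" where
  "const a = [:[:a:]:]"

definition y1 :: "'a::comm_ring_1 poly poly" where
  "y1 = [:[:0, 1:]:]"

definition y2 :: "'a::comm_ring_1 poly poly" where
  "y2 = [:0, 1:]"

definition poisson_double_extension ::
    "('a::char0_algebra \<Rightarrow> 'a \<Rightarrow> 'a) \<Rightarrow> 'a \<Rightarrow> 'a \<Rightarrow> (nat \<Rightarrow> nat \<Rightarrow> 'a \<Rightarrow> 'a) \<Rightarrow> (nat \<Rightarrow> 'a \<Rightarrow> 'a) \<Rightarrow>
     'a \<Rightarrow> 'a \<Rightarrow> 'a \<Rightarrow> ('a poly poly \<Rightarrow> 'a poly poly \<Rightarrow> 'a poly poly) \<Rightarrow> bool" where
  "poisson_double_extension brR q11 q12 \<alpha> \<nu> w1 w2 w0 brS \<longleftrightarrow>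
    q11 \<in> scalars \<and> q12 \<in> scalars \<and>
    (\<forall>i\<in>{1, 2}. \<forall>j\<in>{1, 2}. k_linear (\<alpha> i j)) \<and> (\<forall>i\<in>{1, 2}. k_linear (\<nu> i)) \<and>
    poisson_bracket brS \<and>
    (\<forall>a b. brS (const a) (const b) = const (brR a b)) \<and>
    brS y2 y1 = const q11 * y1\<^sup>2 + const q12 * y1 * y2 + const w1 * y1 + const w2 * y2 + const w0 \<and>
    (\<forall>a. brS y1 (const a) = const (\<alpha> 1 1 a) * y1 + const (\<alpha> 1 2 a) * y2 + const (\<nu> 1 a)) \<and>
    (\<forall>a. brS y2 (const a) = const (\<alpha> 2 1 a) * y1 + const (\<alpha> 2 2 a) * y2 + const (\<nu> 2 a))"

lemma const_hom:
  "const (a + b) = const a + const b"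
  "const (a * b) = const a * const b"
  "c \<in> scalars \<Longrightarrow> const c \<in> scalars"
  by (simp_all add: const_def scalars_poly_def)

text \<open>The map on forms induced by the inclusion of \<open>R\<close> into \<open>R[y\<^sub>1, y\<^sub>2]\<close>.\<close>

lift_definition const_form :: "'a::char0_algebra form \<Rightarrow> 'a poly poly form" is
  "extend (\<lambda>xs b. tensor (const b) (map const xs))"
proof -
  fix u v :: "'a list \<Rightarrow>\<^sub>0 'a"
  assume rel: "form_rel u v"
  let ?g = "\<lambda>xs b. fun_form (const b) * word_form (map const xs)"
  have "extend ?g u = extend ?g v"
  proof (rule extend_respects_form_rel[OF _ _ _ _ _ rel])
    fix xs ys :: "'a list" and f a b :: 'a
    show "?g (xs @ [a + b] @ ys) f = ?g (xs @ [a] @ ys) f + ?g (xs @ [b] @ ys) f"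
      by (simp only: map_append list.map word_form_split const_hom delta_add distrib_left
          distrib_right)
    show "?g (xs @ [a * b] @ ys) f = ?g (xs @ [b] @ ys) (f * a) + ?g (xs @ [a] @ ys) (f * b)"
      by (simp only: map_append list.map word_form_split const_hom delta_mult distrib_left
          distrib_right fun_form_mult mult.assoc fun_form_left_commute[of "word_form _"])
  next
    fix xs ys :: "'a list" and f c :: 'a
    assume "c \<in> scalars"
    then show "?g (xs @ [c] @ ys) f = 0"
      by (simp only: map_append list.map word_form_split const_hom delta_scalar mult_zero_left
          mult_zero_right)
  next
    fix xs ys :: "'a list" and f a :: 'a
    have "word_form ([const a, const a] @ map const ys) = 0"
      using delta_square[of "const a"]
      by (simp add: word_form_Cons[of _ "_ # _"] word_form_Cons[of _ "map _ _"]
          mult.assoc[symmetric])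
    then show "?g (xs @ [a, a] @ ys) f = 0"
      by (simp add: word_form_append[of "map const xs"])
  qed (simp add: const_hom fun_form_add distrib_right)
  then show "form_rel (extend (\<lambda>xs b. tensor (const b) (map const xs)) u)
      (extend (\<lambda>xs b. tensor (const b) (map const xs)) v)"
    by (simp add: form_class_eq_iff[symmetric] form_class_extend form_class_tensor)
qed

definition extended_volume :: "'a::char0_algebra form \<Rightarrow> 'a poly poly form" where
  "extended_volume vol =
     const_form vol \<and>\<^sub>\<Omega> ext_d (fun_form y1) \<and>\<^sub>\<Omega> ext_d (fun_form y2)"

end

theory Submission
  imports Defs
begin

text \<open>
  Two facts make the computation work. First, \<open>dx \<and> vol = 0\<close> for every \<open>x \<in> R\<close>, so that in
  \<open>\<L>\<^sub>H (vol \<and> dy\<^sub>1 \<and> dy\<^sub>2)\<close> the \<open>y\<^sub>i\<close> contribute only the divergence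
  \<open>\<partial>H(y\<^sub>1)/\<partial>y\<^sub>1 + \<partial>H(y\<^sub>2)/\<partial>y\<^sub>2\<close>, while the restriction of the Hamiltonian derivation \<open>H\<close> to \<open>R\<close>
  is an \<open>S\<close>-linear combination of derivations of \<open>R\<close> with coefficients \<open>y\<^sub>1, y\<^sub>2, 1\<close> whose
  differentials are killed by \<open>dy\<^sub>1 \<and> dy\<^sub>2\<close>. Secondly, \<open>g \<mapsto> g vol \<and> dy\<^sub>1 \<and> dy\<^sub>2\<close> is injective on \<open>S\<close>:
  contraction with \<open>\<partial>/\<partial>y\<^sub>1\<close> and \<open>\<partial>/\<partial>y\<^sub>2\<close> reduces this to the annihilator of \<open>vol\<close>, which is closed under
  both derivations and evaluates to \<open>0\<close> at the origin.
\<close>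

section \<open>The Lie derivative on forms\<close>

text \<open>The elements \<open>b dx_1 ... dx_p\<close> span all forms additively, so an identity
  between additive maps of forms need only be checked on them.\<close>

lemma form_induct [case_names zero generator add]:
  assumes "P 0" "\<And>b xs. P (fun_form b * word_form xs)" "\<And>\<omega> \<eta>. P \<omega> \<Longrightarrow> P \<eta> \<Longrightarrow> P (\<omega> + \<eta>)"
  shows "P (\<omega> :: 'a::char0_algebra form)"
proof (induction \<omega> rule: form.abs_induct)
  fix w :: "'a list \<Rightarrow>\<^sub>0 'a"
  show "P (form_class w)"
    by (induction w rule: tensor_induct) (simp_all add: assms form_class_hom form_class_tensor)
qed

lemma word_form_Cons_add: "word_form ((a + b) # xs) = word_form (a # xs) + word_form (b # xs)"
  using word_form_Cons[of "a + b" xs] word_form_Cons[of a xs] word_form_Cons[of b xs]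
  by (simp add: delta_add distrib_right)

section \<open>The exterior derivative as an antiderivation\<close>

lemma ext_d_add: "ext_d (\<omega> + \<eta>) = ext_d \<omega> + ext_d \<eta>"
proof (induction \<omega> rule: form.abs_induct, induction \<eta> rule: form.abs_induct)
  fix u v :: "'a list \<Rightarrow>\<^sub>0 'a"
  show "ext_d (form_class v + form_class u) = ext_d (form_class v) + ext_d (form_class u)"
    unfolding form_class_hom(1)[symmetric] ext_d.abs_eq form_class_extend
    by (rule extend_add) (simp add: form_class_tensor word_form_Cons_add)
qed

lemma ext_d_0 [simp]: "ext_d 0 = 0"
  by (rule additive_0[OF ext_d_add])

lemma ext_d_uminus: "ext_d (- \<omega>) = - ext_d \<omega>"
  using ext_d_add[of \<omega> "- \<omega>"] by (simp add: eq_neg_iff_add_eq_0 add.commute)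

lemma ext_d_diff: "ext_d (\<omega> - \<eta>) = ext_d \<omega> - ext_d \<eta>"
  using ext_d_add[of \<omega> "- \<eta>"] by (simp add: ext_d_uminus)

lemma ext_d_generator: "ext_d (fun_form b * word_form xs) = word_form (b # xs)"
  unfolding form_class_tensor[symmetric] ext_d.abs_eq form_class_extend
  by (subst extend_single)
    (simp_all add: form_class_tensor word_form_Cons_add)

lemma delta_1 [simp]: "word_form [1] = 0"
  by (rule delta_scalar) (rule one_in_scalars)

lemma ext_d_word_form [simp]: "ext_d (word_form xs) = 0"
  using ext_d_generator[of 1 xs] word_form_Cons[of 1 xs] by simp

lemma ext_d_fun_form: "ext_d (fun_form b) = word_form [b]"
  using ext_d_generator[of b "[]"] by simp

lemma delta_mult_generator:
  "word_form [x] * (fun_form b * word_form xs) = fun_form b * word_form (x # xs)"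
  by (simp add: fun_form_left_commute[of "word_form _"] word_form_Cons[of x xs])

text \<open>Since d(dx) = 0, the only effect is the sign from moving the new leading factor db past
  dx.\<close>

lemma ext_d_delta_mult: "ext_d (word_form [x] * \<omega>) = - (word_form [x] * ext_d \<omega>)"
proof (induction \<omega> rule: form_induct)
  case (generator b xs)
  have "word_form (b # x # xs) = word_form [b] * word_form [x] * word_form xs"
    by (simp add: word_form_append[symmetric])
  also have "\<dots> = - (word_form [x] * word_form (b # xs))"
    by (simp add: delta_anticommute[of b x] mult.assoc word_form_Cons[of b xs]
        word_form_Cons[of x "b # xs"])
  finally show ?case
    by (simp only: delta_mult_generator ext_d_generator)
qed (simp_all add: ext_d_add distrib_left)

lemma ext_d_fun_mult: "ext_d (fun_form a * \<omega>) = word_form [a] * \<omega> + fun_form a * ext_d \<omega>"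
proof (induction \<omega> rule: form_induct)
  case (generator b xs)
  have "ext_d (fun_form (a * b) * word_form xs) =
      fun_form a * word_form (b # xs) + fun_form b * word_form (a # xs)"
    by (simp add: ext_d_generator word_form_Cons[of "a * b" xs] word_form_Cons[of a xs]
        word_form_Cons[of b xs] delta_mult distrib_right mult.assoc)
  then show ?case
    by (simp add: fun_form_mult mult.assoc ext_d_generator delta_mult_generator)
qed (simp_all add: ext_d_add distrib_left)

section \<open>Derivations and contraction\<close>

lemma derivationD:
  assumes "derivation D"
  shows "D (a + b) = D a + D b" "D (a * b) = a * D b + b * D a"
    and "c \<in> scalars \<Longrightarrow> D c = 0"
proof -
  show add: "D (a + b) = D a + D b" and mult: "D (a * b) = a * D b + b * D a" for a b
    using assms by (simp_all add: derivation_def k_linear_def)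
  have "D 1 = 0" using mult[of 1 1] by simp
  then show "D c = 0" if "c \<in> scalars"
    using assms that unfolding derivation_def k_linear_def
    by (metis mult.right_neutral mult_zero_right)
qed

lemma derivation_0 [simp]: "derivation D \<Longrightarrow> D 0 = 0"
  by (rule additive_0[OF derivationD(1)])

lemma derivation_uminus: "derivation D \<Longrightarrow> D (- a) = - D a"
  using derivationD(1)[of D a "- a"] by (simp add: eq_neg_iff_add_eq_0 add.commute)

lemma derivation_diff: "derivation D \<Longrightarrow> D (a - b) = D a - D b"
  using derivationD(1)[of D a "- b"] derivation_uminus[of D b] by simp

lemma contraction_add: "contraction D (\<omega> + \<eta>) = contraction D \<omega> + contraction D \<eta>"
proof (induction \<omega> rule: form.abs_induct, induction \<eta> rule: form.abs_induct)
  fix u v :: "'a list \<Rightarrow>\<^sub>0 'a"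
  have "extend (\<lambda>xs b. form_class (tensor b [] * contract_word D xs)) (v + u) =
    extend (\<lambda>xs b. form_class (tensor b [] * contract_word D xs)) v +
    extend (\<lambda>xs b. form_class (tensor b [] * contract_word D xs)) u"
    by (rule extend_add) (simp add: form_class_hom single_add distrib_right)
  then show "contraction D (form_class v + form_class u) =
      contraction D (form_class v) + contraction D (form_class u)"
    unfolding form_class_hom(1)[symmetric] contraction.abs_eq
    by (cases "derivation D") (simp_all add: form_class_extend form_class_hom(1,5))
qed

lemma contraction_0 [simp]: "contraction D 0 = 0"
  by (rule additive_0[OF contraction_add])

lemma contraction_generator:
  assumes "derivation D"
  shows "contraction D (fun_form b * word_form xs) = fun_form b * form_class (contract_word D xs)"
  unfolding form_class_tensor[symmetric] contraction.abs_eq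
  by (simp add: assms form_class_extend, subst extend_single)
    (simp_all add: form_class_hom single_add distrib_right form_class_tensor)

lemma contraction_word_form:
  assumes "derivation D"
  shows "contraction D (word_form xs) = form_class (contract_word D xs)"
  using contraction_generator[OF assms, of 1 xs] by simp

lemma contraction_fun_mult: "contraction D (fun_form a * \<omega>) = fun_form a * contraction D \<omega>"
proof (cases "derivation D")
  case True
  show ?thesis
  proof (induction \<omega> rule: form_induct)
    case (generator b xs)
    show ?case
      using contraction_generator[OF True, of "a * b" xs]
      by (simp add: contraction_generator[OF True] fun_form_mult mult.assoc)
  qed (simp_all add: contraction_add distrib_left)
next
  \<comment> \<open>Outside derivations \<open>contraction\<close> is 0 by definition, so both sides
    vanish.\<close>
  case False
  then have "contraction D \<omega> = 0" for \<omega>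
    by (induction \<omega> rule: form.abs_induct) (simp add: contraction.abs_eq form_class_hom)
  then show ?thesis by simp
qed

text \<open>On generators this is the recursion of \<open>contract_word\<close>; commuting function
  coefficients to the front lifts it to all forms.\<close>

lemma contraction_delta_mult:
  assumes "derivation D"
  shows "contraction D (word_form [x] * \<omega>) = fun_form (D x) * \<omega> - word_form [x] * contraction D \<omega>"
proof (induction \<omega> rule: form_induct)
  case (generator b xs)
  show ?case
    unfolding delta_mult_generator contraction_generator[OF assms] form_class_contract_word
    by (simp add: right_diff_distrib fun_form_left_commute[of "word_form _"]
        fun_form_left_commute[of "fun_form b" "D x"])
qed (simp_all add: contraction_add distrib_left)

section \<open>Product rules for the Lie derivative\<close>

lemma lie_derivative_add: "lie_derivative D (\<omega> + \<eta>) = lie_derivative D \<omega> + lie_derivative D \<eta>"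
  by (simp add: lie_derivative_def ext_d_add contraction_add)

lemma lie_derivative_0 [simp]: "lie_derivative D 0 = 0"
  by (rule additive_0[OF lie_derivative_add])

text \<open>In Cartan's formula the exterior derivative of the contraction produces da wedge
  \<open>contraction D \<omega>\<close>, and the contraction of da wedge \<open>\<omega>\<close>
  produces the same term with the opposite sign.\<close>

lemma lie_derivative_fun_mult:
  assumes "derivation D"
  shows "lie_derivative D (fun_form a * \<omega>) = fun_form (D a) * \<omega> + fun_form a * lie_derivative D \<omega>"
  by (simp add: lie_derivative_def contraction_fun_mult ext_d_fun_mult contraction_add
      contraction_delta_mult[OF assms] distrib_left)

text \<open>The two terms \<open>D x\<close> times \<open>ext_d \<omega>\<close> cancel, leaving d(D
  x) as the derivative of dx. With the rule for functions and the value on the empty word, this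
  computes the Lie derivative of every form.\<close>

lemma lie_derivative_delta_mult:
  assumes "derivation D"
  shows "lie_derivative D (word_form [x] * \<omega>) =
    word_form [D x] * \<omega> + word_form [x] * lie_derivative D \<omega>"
proof -
  have "contraction D (- (word_form [x] * ext_d \<omega>)) = - contraction D (word_form [x] * ext_d \<omega>)"
    using contraction_add[of D "word_form [x] * ext_d \<omega>" "- (word_form [x] * ext_d \<omega>)"]
    by (simp add: eq_neg_iff_add_eq_0 add.commute)
  then show ?thesis
    by (simp add: lie_derivative_def ext_d_delta_mult contraction_delta_mult[OF assms] ext_d_diff
        ext_d_fun_mult distrib_left)
qed

lemma lie_derivative_word_Nil:
  assumes "derivation D"
  shows "lie_derivative D (word_form []) = 0"
  by (simp add: lie_derivative_def contraction_word_form[OF assms] form_class_contract_word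
      del: contract_word.simps)

section \<open>Top forms of a smooth affine algebra\<close>

lemma forms_of_degree_generator: "length xs = p \<Longrightarrow> fun_form b * word_form xs \<in> forms_of_degree p"
  unfolding forms_of_degree_def form_class_tensor[symmetric]
  by (rule imageI) auto

lemma forms_of_degree_0 [simp]: "0 \<in> forms_of_degree p"
  using forms_of_degree_generator[of "replicate p 0" p 0] by simp

lemma forms_of_degree_add:
  assumes "\<omega> \<in> forms_of_degree p" "\<eta> \<in> forms_of_degree p"
  shows "\<omega> + \<eta> \<in> forms_of_degree p"
proof -
  from assms obtain u v where u: "\<omega> = form_class u" "\<forall>xs\<in>Poly_Mapping.keys u. length xs = p"
    and v: "\<eta> = form_class v" "\<forall>xs\<in>Poly_Mapping.keys v. length xs = p"
    unfolding forms_of_degree_def by blast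
  have "\<forall>xs\<in>Poly_Mapping.keys (u + v). length xs = p"
    using u(2) v(2) Poly_Mapping.keys_add[of u v] by blast
  then show ?thesis
    unfolding forms_of_degree_def u(1) v(1) form_class_hom(1)[symmetric] by blast
qed

lemma forms_of_degree_expand:
  assumes "\<omega> \<in> forms_of_degree p"
  obtains A c where "finite A" "\<And>xs. xs \<in> A \<Longrightarrow> length xs = p"
    "\<omega> = (\<Sum>xs\<in>A. fun_form (c xs) * word_form xs)"
proof -
  from assms obtain w where w: "\<omega> = form_class w" "\<forall>xs\<in>Poly_Mapping.keys w. length xs = p"
    unfolding forms_of_degree_def by blast
  have "w = (\<Sum>xs\<in>Poly_Mapping.keys w. tensor (Poly_Mapping.lookup w xs) xs)"
    by (rule poly_mapping_eqI) (simp add: lookup_sum lookup_single when_def in_keys_iff)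
  then have "\<omega> = (\<Sum>xs\<in>Poly_Mapping.keys w. fun_form (Poly_Mapping.lookup w xs) * word_form xs)"
    unfolding w(1) form_class_tensor[symmetric] form_class_sum[symmetric] by simp
  with w(2) that[of "Poly_Mapping.keys w"] show ?thesis by simp
qed

lemma forms_of_degree_induct [consumes 1, case_names zero generator add]:
  assumes "\<omega> \<in> forms_of_degree p"
    and "P 0" "\<And>b xs. length xs = p \<Longrightarrow> P (fun_form b * word_form xs)"
    and "\<And>\<omega> \<eta>. P \<omega> \<Longrightarrow> P \<eta> \<Longrightarrow> P (\<omega> + \<eta>)"
  shows "P \<omega>"
proof -
  obtain A c where A: "finite A" "\<And>xs. xs \<in> A \<Longrightarrow> length xs = p"
    "\<omega> = (\<Sum>xs\<in>A. fun_form (c xs) * word_form xs)"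
    using forms_of_degree_expand[OF assms(1)] by blast
  have "P (\<Sum>xs\<in>A. fun_form (c xs) * word_form xs)"
    using A(1,2) by (induction A) (simp_all add: assms(2-4))
  then show ?thesis by (simp add: A(3))
qed

lemma forms_of_degree_scale:
  "\<omega> \<in> forms_of_degree p \<Longrightarrow> fun_form a * \<omega> \<in> forms_of_degree p"
proof (induction rule: forms_of_degree_induct)
  case (generator b xs)
  then show ?case
    using forms_of_degree_generator[of xs p "a * b"] by (simp add: fun_form_mult mult.assoc)
qed (simp_all add: distrib_left forms_of_degree_add)

lemma forms_of_degree_delta_mult:
  "\<omega> \<in> forms_of_degree p \<Longrightarrow> word_form [a] * \<omega> \<in> forms_of_degree (Suc p)"
proof (induction rule: forms_of_degree_induct)
  case (generator b xs)
  then show ?case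
    by (simp add: delta_mult_generator forms_of_degree_generator)
qed (simp_all add: distrib_left forms_of_degree_add)

lemma word_form_of_degree: "word_form xs \<in> forms_of_degree (length xs)"
  using forms_of_degree_generator[of xs "length xs" 1] by simp

text \<open>Each step replaces one factor dx by d(D x) or differentiates the coefficient. Hence the
  Lie derivative of a volume form is a multiple of it, which makes the modular derivation of R
  meaningful.\<close>

lemma lie_derivative_of_degree:
  assumes "derivation D" "\<omega> \<in> forms_of_degree p"
  shows "lie_derivative D \<omega> \<in> forms_of_degree p"
proof -
  have word: "lie_derivative D (word_form xs) \<in> forms_of_degree (length xs)" for xs
  proof (induction xs)
    case (Cons x xs)
    have "word_form [D x] * word_form xs \<in> forms_of_degree (Suc (length xs))"
      by (rule forms_of_degree_delta_mult) (rule word_form_of_degree)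
    then show ?case
      using forms_of_degree_delta_mult[OF Cons, of x]
      by (simp add: word_form_Cons[of x xs] lie_derivative_delta_mult[OF assms(1)]
          forms_of_degree_add)
  qed (simp add: lie_derivative_word_Nil[OF assms(1)])
  from assms(2) show ?thesis
  proof (induction rule: forms_of_degree_induct)
    case (generator b xs)
    then show ?case
      using word[of xs]
      by (simp add: lie_derivative_fun_mult[OF assms(1)] forms_of_degree_add forms_of_degree_scale
          forms_of_degree_generator)
  qed (simp_all add: lie_derivative_add forms_of_degree_add)
qed

lemma volume_form_coeff_unique:
  assumes "volume_form n vol" "fun_form a * vol = fun_form b * vol"
  shows "a = b"
proof -
  have "fun_form a * vol \<in> forms_of_degree n"
    using assms(1) by (simp add: volume_form_def forms_of_degree_scale)
  then have "\<exists>!c. fun_form a * vol = fun_form c * vol"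
    using assms(1) by (simp add: volume_form_def)
  with assms(2) show ?thesis by blast
qed

section \<open>Annihilators and the unit ideal\<close>

text \<open>Every monomial of degree k + l in a and b contains a^k or b^l. In place of the binomial
  formula, one factor a + b is split off and the induction hypothesis is applied to
  \<open>a \<omega>\<close> and \<open>b \<omega>\<close>.\<close>

lemma power_annihilates_add:
  assumes "fun_form (a ^ k) * \<omega> = 0" "fun_form (b ^ l) * \<omega> = 0"
  shows "fun_form ((a + b) ^ (k + l)) * \<omega> = 0"
  using assms
proof (induction "k + l" arbitrary: k l \<omega>)
  case (Suc m)
  show ?case
  proof (cases "k = 0 \<or> l = 0")
    case True
    with Suc.prems have "\<omega> = 0" by auto
    then show ?thesis by simp
  next
    case False
    then obtain k' l' where kl: "k = Suc k'" "l = Suc l'" by (metis not0_implies_Suc)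
    have m: "m = k' + l" "m = k + l'" using Suc.hyps(2) by (simp_all add: kl)
    have commute: "fun_form x * (fun_form y * \<omega>) = fun_form y * (fun_form x * \<omega>)" for x y
      by (rule fun_form_left_commute)
    have "fun_form (a ^ k') * (fun_form a * \<omega>) = 0"
      using Suc.prems(1) by (simp only: kl power_Suc2 fun_form_mult mult.assoc)
    moreover have "fun_form (b ^ l) * (fun_form a * \<omega>) = 0"
      unfolding commute[of _ a] Suc.prems(2) by simp
    ultimately have "fun_form ((a + b) ^ (k' + l)) * (fun_form a * \<omega>) = 0"
      by (rule Suc.hyps(1)[OF m(1)])
    moreover have "fun_form (b ^ l') * (fun_form b * \<omega>) = 0"
      using Suc.prems(2) by (simp only: kl power_Suc2 fun_form_mult mult.assoc)
    then have "fun_form ((a + b) ^ (k + l')) * (fun_form b * \<omega>) = 0"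
      by (rule Suc.hyps(1)[OF m(2), rotated]) (simp add: commute[of _ b] Suc.prems(1))
    moreover have "(a + b) ^ (k + l) = (a + b) ^ (k' + l) * a + (a + b) ^ (k + l') * b"
      by (simp add: kl algebra_simps)
    ultimately show ?thesis
      by (simp add: fun_form_add fun_form_mult distrib_right mult.assoc)
  qed
qed simp

text \<open>The radical of the annihilator of \<open>\<omega>\<close> is an ideal. It contains every
  \<open>c x\<close>, hence 1, and a power of 1 is 1.\<close>

lemma unit_combination_annihilates:
  assumes "finite A" "\<And>x. x \<in> A \<Longrightarrow> fun_form ((c x)\<^sup>2) * \<omega> = 0" "(\<Sum>x\<in>A. f x * c x) = 1"
  shows "\<omega> = 0"
proof -
  have "\<exists>k. fun_form ((\<Sum>x\<in>A. f x * c x) ^ k) * \<omega> = 0"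
    using assms(1,2)
  proof (induction A)
    case empty
    \<comment> \<open>The empty sum is 0, and 0 ^ 0 = 1, so the exponent has to be positive.\<close>
    show ?case by (intro exI[of _ 1]) simp
  next
    case (insert x A)
    then obtain k where "fun_form ((\<Sum>x\<in>A. f x * c x) ^ k) * \<omega> = 0" by auto
    moreover have "fun_form ((f x * c x)\<^sup>2) * \<omega> = 0"
      using insert.prems[of x] by (simp add: power_mult_distrib fun_form_mult mult.assoc)
    ultimately have "fun_form ((f x * c x + (\<Sum>x\<in>A. f x * c x)) ^ (2 + k)) * \<omega> = 0"
      by (intro power_annihilates_add)
    with insert.hyps show ?case by (intro exI[of _ "2 + k"]) simp
  qed
  with assms(3) show ?thesis by simp
qed

text \<open>Exchanging one factor of \<open>dx\<^sub>1 \<and> \<dots> \<and> dx\<^sub>n = c vol\<close> shows that \<open>c\<^sup>2\<close> kills \<open>dx \<and> vol\<close>, and the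
  coefficients \<open>c\<close> generate the unit ideal. For \<open>n = 0\<close> every algebra has a
  volume form; there smoothness gives \<open>\<Omega>\<^sup>1 = 0\<close> by Nakayama's lemma.\<close>

lemma delta_mult_volume_positive_degree:
  assumes vol: "volume_form n vol" and n: "n > 0"
  shows "word_form [x] * vol = 0"
proof -
  have "\<exists>c. word_form xs = fun_form c * vol" if "length xs = n" for xs
    using vol word_form_of_degree[of xs] that unfolding volume_form_def by blast
  then obtain c where c: "\<And>xs. length xs = n \<Longrightarrow> word_form xs = fun_form (c xs) * vol"
    by metis
  have square: "fun_form ((c xs)\<^sup>2) * (word_form [x] * vol) = 0" if xs: "length xs = n" for xs
  proof -
    obtain w ws where ws: "xs = w # ws" using xs n by (cases xs) auto
    have "fun_form (c xs) * (word_form [x] * vol) = word_form [x] * word_form xs"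
      using fun_form_left_commute[of "word_form [x]" "c xs" vol] by (simp add: c[OF xs])
    also have "\<dots> = - (word_form [w] * word_form (x # ws))"
      by (simp add: ws word_form_Cons[of w ws] word_form_Cons[of x ws] mult.assoc[symmetric]
          delta_anticommute[of x w])
    also have "\<dots> = - (fun_form (c (x # ws)) * (word_form [w] * vol))"
      using xs by (simp add: ws c[of "x # ws"] fun_form_left_commute[of "word_form [w]"])
    \<comment> \<open>The second factor \<open>c xs\<close> turns \<open>vol\<close> back into the
      word \<open>w # ws\<close>, so that dw meets another dw.\<close>
    finally have "fun_form (c xs) * (fun_form (c xs) * (word_form [x] * vol)) =
        - (fun_form (c (x # ws)) * (word_form [w] * (fun_form (c xs) * vol)))"
      by (simp add: fun_form_left_commute[of "fun_form (c xs)"]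
          fun_form_left_commute[of "word_form [w]"])
    also have "\<dots> = - (fun_form (c (x # ws)) * (word_form [w] * word_form [w] * word_form ws))"
      by (simp only: c[OF xs, symmetric]) (simp add: ws word_form_Cons[of w ws] mult.assoc)
    finally show ?thesis
      by (simp add: delta_square power2_eq_square fun_form_mult mult.assoc)
  qed
  have "vol \<in> forms_of_degree n" using vol by (simp add: volume_form_def)
  then obtain A f where A: "finite A" "\<And>xs. xs \<in> A \<Longrightarrow> length xs = n"
    "vol = (\<Sum>xs\<in>A. fun_form (f xs) * word_form xs)"
    using forms_of_degree_expand by blast
  have fun_form_sum: "fun_form (\<Sum>xs\<in>A. f xs * c xs) * vol = (\<Sum>xs\<in>A. fun_form (f xs * c xs) * vol)"
    using A(1) by induction (simp_all add: fun_form_add distrib_right)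
  \<comment> \<open>Expanding \<open>vol\<close> in words and each word in \<open>vol\<close>
    exhibits 1 as a combination of the coefficients \<open>c xs\<close>.\<close>
  have "vol = (\<Sum>xs\<in>A. fun_form (f xs) * (fun_form (c xs) * vol))"
    by (subst A(3), rule sum.cong) (simp_all add: A(2) c[symmetric])
  then have "fun_form 1 * vol = fun_form (\<Sum>xs\<in>A. f xs * c xs) * vol"
    unfolding fun_form_sum by (simp add: fun_form_mult mult.assoc)
  then have "(\<Sum>xs\<in>A. f xs * c xs) = 1"
    using volume_form_coeff_unique[OF vol, of 1] by simp
  with A(1,2) square show ?thesis
    by (intro unit_combination_annihilates[of A c "word_form [x] * vol" f]) simp_all
qed

section \<open>Prime ideals and dimension\<close>

text \<open>Krull's theorem: Zorn's lemma yields an ideal maximal among the proper ones containing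
  I, and such an ideal is prime.\<close>

lemma ideal_subset_prime_ideal:
  assumes I: "0 \<in> I" "\<And>a b. a \<in> I \<Longrightarrow> b \<in> I \<Longrightarrow> a + b \<in> I" "\<And>a b. a \<in> I \<Longrightarrow> b * a \<in> I"
    and proper: "(1 :: 'a::comm_ring_1) \<notin> I"
  shows "\<exists>P. prime_ideal P \<and> I \<subseteq> P"
proof -
  define ideal where "ideal J \<longleftrightarrow>
    0 \<in> J \<and> (\<forall>a\<in>J. \<forall>b\<in>J. a + b \<in> J) \<and> (\<forall>a\<in>J. \<forall>b. b * a \<in> J)" for J :: "'a set"
  define F where "F = {J. ideal J \<and> I \<subseteq> J \<and> 1 \<notin> J}"
  have "\<exists>M\<in>F. \<forall>J\<in>F. M \<subseteq> J \<longrightarrow> J = M"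
  proof (rule subset_Zorn_nonempty)
    have "I \<in> F" using I proper by (auto simp: F_def ideal_def)
    then show "F \<noteq> {}" by blast
  next
    fix C assume C: "C \<noteq> {}" "subset.chain F C"
    then have F: "J \<in> F" if "J \<in> C" for J
      using that by (auto simp: subset.chain_def)
    have "ideal (\<Union>C)"
      unfolding ideal_def
    proof (intro conjI ballI allI)
      obtain J where "J \<in> C" using C(1) by blast
      then show "0 \<in> \<Union>C" using F[of J] by (auto simp: F_def ideal_def)
    next
      fix a b assume "a \<in> \<Union>C" "b \<in> \<Union>C"
      then obtain J K where JK: "J \<in> C" "K \<in> C" "a \<in> J" "b \<in> K" by blast
      have "J \<subseteq> K \<or> K \<subseteq> J"
        using C(2) JK by (auto simp: subset.chain_def)
      then show "a + b \<in> \<Union>C"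
      proof
        assume "J \<subseteq> K"
        then have "a + b \<in> K" using JK F[of K] by (auto simp: F_def ideal_def)
        then show ?thesis using JK(2) by blast
      next
        assume "K \<subseteq> J"
        then have "a + b \<in> J" using JK F[of J] by (auto simp: F_def ideal_def)
        then show ?thesis using JK(1) by blast
      qed
    next
      fix a b assume "a \<in> \<Union>C"
      then obtain J where J: "J \<in> C" "a \<in> J" by blast
      then have "b * a \<in> J" using F[of J] by (auto simp: F_def ideal_def)
      then show "b * a \<in> \<Union>C" using J(1) by blast
    qed
    moreover have "I \<subseteq> \<Union>C" using C(1) F by (auto simp: F_def)
    moreover have "1 \<notin> \<Union>C" using F by (auto simp: F_def)
    ultimately show "\<Union>C \<in> F" by (simp add: F_def)
  qed
  then obtain M where M: "M \<in> F" "\<And>J. J \<in> F \<Longrightarrow> M \<subseteq> J \<Longrightarrow> J = M" by blast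
  then have id: "0 \<in> M" "\<And>a b. a \<in> M \<Longrightarrow> b \<in> M \<Longrightarrow> a + b \<in> M" "\<And>a b. a \<in> M \<Longrightarrow> b * a \<in> M"
    "I \<subseteq> M" "1 \<notin> M"
    by (auto simp: F_def ideal_def)
  have "a \<in> M \<or> b \<in> M" if ab: "a * b \<in> M" for a b
  proof (rule ccontr)
    assume not: "\<not> (a \<in> M \<or> b \<in> M)"
    \<comment> \<open>The ideal M + Ra is proper, since 1 = m + ra multiplied by b would put b into
      M. Maximality then forces it to equal M, although it contains a.\<close>
    let ?J = "{m + r * a |m r. m \<in> M}"
    have "M \<subseteq> ?J"
    proof
      fix m assume "m \<in> M"
      then show "m \<in> ?J" by (intro CollectI exI[of _ m] exI[of _ 0]) simp
    qed
    have a: "a \<in> ?J"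
      using id(1) by (intro CollectI exI[of _ 0] exI[of _ 1]) simp
    have "ideal ?J"
      unfolding ideal_def
    proof (intro conjI ballI allI)
      show "0 \<in> ?J" using \<open>M \<subseteq> ?J\<close> id(1) by blast
    next
      fix x y assume "x \<in> ?J" "y \<in> ?J"
      then obtain m r m' r' where xy: "m \<in> M" "m' \<in> M" "x = m + r * a" "y = m' + r' * a" by blast
      have "x + y = (m + m') + (r + r') * a" by (simp add: xy algebra_simps)
      then show "x + y \<in> ?J" using id(2)[OF xy(1,2)] by blast
    next
      fix x y assume "x \<in> ?J"
      then obtain m r where x: "m \<in> M" "x = m + r * a" by blast
      have "y * x = y * m + (y * r) * a" by (simp add: x algebra_simps)
      then show "y * x \<in> ?J" using id(3)[OF x(1)] by blast
    qed
    moreover have "1 \<notin> ?J"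
    proof
      assume "1 \<in> ?J"
      then obtain m r where mr: "m \<in> M" "1 = m + r * a" by blast
      have "b = (m + r * a) * b" by (simp add: mr(2)[symmetric])
      also have "\<dots> = b * m + r * (a * b)" by (simp add: algebra_simps)
      also have "\<dots> \<in> M" using id mr(1) ab by blast
      finally show False using not by blast
    qed
    ultimately have "?J \<in> F" using \<open>M \<subseteq> ?J\<close> id(4) by (auto simp: F_def)
    from M(2)[OF this \<open>M \<subseteq> ?J\<close>] a not show False by blast
  qed
  with id show ?thesis
    by (intro exI[of _ M]) (auto simp: prime_ideal_def)
qed

lemma quotient_dim_antimono:
  fixes Q Q' :: "'a::comm_ring_1 set"
  assumes "Q' \<subseteq> Q"
  shows "quotient_dim Q \<le> quotient_dim Q'"
proof -
  have "(\<forall>i\<le>m. prime_ideal (P i) \<and> Q' \<subseteq> P i)" if "\<forall>i\<le>m. prime_ideal (P i) \<and> Q \<subseteq> P i"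
    for P :: "nat \<Rightarrow> 'a set" and m
    using that assms by (meson order_trans)
  note step = this
  show ?thesis
    unfolding quotient_dim_def
    by (intro Sup_subset_mono Collect_mono impI, elim exE conjE, intro exI conjI)
      (assumption | erule step)+
qed

text \<open>Every prime contains 0, so chains above it count for the whole ring. This carries Krull
  dimension 0 over to each point of the spectrum.\<close>

lemma local_dim_le_krull_dim: "local_dim (P :: 'a::comm_ring_1 set) \<le> krull_dim TYPE('a)"
  unfolding local_dim_def krull_dim_def
  by (intro SUP_least quotient_dim_antimono) (simp add: prime_ideal_def)

section \<open>Finite generation of Omega^1 and Nakayama's lemma\<close>

text \<open>Additivity and the Leibniz rule follow the construction of an element from algebra
  generators; this makes Omega^1 finitely generated, as Nakayama's lemma requires.\<close>

lemma delta_span_generators: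
  assumes G: "finite G" "subalgebra_generated G = (UNIV :: 'a::char0_algebra set)"
  shows "\<exists>c. word_form [a] = (\<Sum>g\<in>G. fun_form (c g) * word_form [g])"
proof -
  have "a \<in> subalgebra_generated G" by (simp add: G(2))
  then show ?thesis
  proof induction
    case (scalar c)
    then show ?case by (intro exI[of _ "\<lambda>_. 0"]) (simp add: delta_scalar)
  next
    case (generator g)
    have "(\<Sum>h\<in>G. fun_form (if h = g then 1 else 0) * word_form [h]) =
        (\<Sum>h\<in>G. if h = g then word_form [h] else 0)"
      by (rule sum.cong) simp_all
    also have "\<dots> = word_form [g]" using generator G(1) by (simp add: sum.delta)
    finally show ?case by (intro exI[of _ "\<lambda>h. if h = g then 1 else 0"]) (rule sym)
  next
    case (add a b)
    then obtain c c' where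
      "word_form [a] = (\<Sum>g\<in>G. fun_form (c g) * word_form [g])"
      "word_form [b] = (\<Sum>g\<in>G. fun_form (c' g) * word_form [g])" by blast
    then have "word_form [a + b] = (\<Sum>g\<in>G. fun_form (c g + c' g) * word_form [g])"
      by (simp add: delta_add fun_form_add distrib_right sum.distrib)
    then show ?case by (intro exI[of _ "\<lambda>g. c g + c' g"]) simp
  next
    case (mult a b)
    then obtain c c' where
      "word_form [a] = (\<Sum>g\<in>G. fun_form (c g) * word_form [g])"
      "word_form [b] = (\<Sum>g\<in>G. fun_form (c' g) * word_form [g])" by blast
    then have "word_form [a * b] = (\<Sum>g\<in>G. fun_form (a * c' g + b * c g) * word_form [g])"
      by (simp add: delta_mult fun_form_add fun_form_mult distrib_right sum.distrib mult.assoc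
          sum_distrib_left)
    then show ?case by (intro exI[of _ "\<lambda>g. a * c' g + b * c g"]) simp
  qed
qed

lemma degree_1_span_generators:
  assumes G: "finite G" "subalgebra_generated G = (UNIV :: 'a::char0_algebra set)"
    and "\<omega> \<in> forms_of_degree 1"
  shows "\<exists>c. \<omega> = (\<Sum>g\<in>G. fun_form (c g) * word_form [g])"
  using assms(3)
proof (induction rule: forms_of_degree_induct)
  case zero
  show ?case by (intro exI[of _ "\<lambda>_. 0"]) simp
next
  case (generator b xs)
  then obtain a where "xs = [a]" by (auto simp: length_Suc_conv)
  moreover obtain c where "word_form [a] = (\<Sum>g\<in>G. fun_form (c g) * word_form [g])"
    using delta_span_generators[OF G] by blast
  ultimately have "fun_form b * word_form xs = (\<Sum>g\<in>G. fun_form (b * c g) * word_form [g])"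
    by (simp add: sum_distrib_left fun_form_mult mult.assoc)
  then show ?case by (intro exI[of _ "\<lambda>g. b * c g"]) simp
next
  case (add \<omega> \<eta>)
  then obtain c c' where
    "\<omega> = (\<Sum>g\<in>G. fun_form (c g) * word_form [g])"
    "\<eta> = (\<Sum>g\<in>G. fun_form (c' g) * word_form [g])" by blast
  then have "\<omega> + \<eta> = (\<Sum>g\<in>G. fun_form (c g + c' g) * word_form [g])"
    by (simp add: fun_form_add distrib_right sum.distrib)
  then show ?case by (intro exI[of _ "\<lambda>g. c g + c' g"]) simp
qed

lemma ideal_times_forms_span_generators:
  assumes G: "finite G" "subalgebra_generated G = (UNIV :: 'a::char0_algebra set)"
    and P: "prime_ideal P" and "\<omega> \<in> ideal_times_forms P"
  shows "\<exists>c. (\<forall>g\<in>G. c g \<in> P) \<and> \<omega> = (\<Sum>g\<in>G. fun_form (c g) * word_form [g])"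
proof -
  obtain m p \<eta> where \<omega>: "\<omega> = (\<Sum>i<(m::nat). fun_form (p i) * \<eta> i)"
    and "\<forall>i<m. p i \<in> P \<and> \<eta> i \<in> forms_of_degree 1"
    using assms(4) unfolding ideal_times_forms_def by blast
  then show ?thesis
    unfolding \<omega>
  proof (induction m)
    case 0
    then show ?case using P by (intro exI[of _ "\<lambda>_. 0"]) (simp add: prime_ideal_def)
  next
    case (Suc m)
    then obtain c where c: "\<forall>g\<in>G. c g \<in> P"
      "(\<Sum>i<m. fun_form (p i) * \<eta> i) = (\<Sum>g\<in>G. fun_form (c g) * word_form [g])"
      using less_SucI by blast
    obtain c' where c': "\<eta> m = (\<Sum>g\<in>G. fun_form (c' g) * word_form [g])"
      using Suc.prems degree_1_span_generators[OF G] by blast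
    have "(\<Sum>i<Suc m. fun_form (p i) * \<eta> i) = (\<Sum>g\<in>G. fun_form (c g + c' g * p m) * word_form [g])"
      by (simp add: c(2) c' fun_form_add fun_form_mult[of "p m"] mult.commute[of _ "p m"]
          distrib_right sum.distrib sum_distrib_left mult.assoc)
    moreover have "\<forall>g\<in>G. c g + c' g * p m \<in> P"
      using P c(1) Suc.prems by (simp add: prime_ideal_def)
    ultimately show ?case by (intro exI[of _ "\<lambda>g. c g + c' g * p m"]) simp
  qed
qed

text \<open>Nakayama's lemma at \<open>P\<close>, by eliminating one generator at a time.\<close>

lemma nakayama_at_prime:
  fixes z :: "'b \<Rightarrow> 'a::char0_algebra form"
  assumes "finite G" and P: "prime_ideal P"
    and "\<And>g. g \<in> G \<Longrightarrow> \<exists>t p. t \<notin> P \<and> (\<forall>h\<in>G. p h \<in> P) \<and>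
      fun_form t * z g = (\<Sum>h\<in>G. fun_form (p h) * z h)"
  shows "\<exists>s. s \<notin> P \<and> (\<forall>g\<in>G. fun_form s * z g = 0)"
  using assms(1,3)
proof (induction G)
  case empty
  then show ?case using P by (auto simp: prime_ideal_def)
next
  case (insert g G)
  have P_add: "a + b \<in> P" if "a \<in> P" "b \<in> P" for a b
    using P that by (simp add: prime_ideal_def)
  have P_mult: "a * b \<in> P" if "a \<in> P \<or> b \<in> P" for a b
    using P that by (metis mult.commute prime_ideal_def)
  have not_mult: "a * b \<notin> P" if "a \<notin> P" "b \<notin> P" for a b
    using P that by (auto simp: prime_ideal_def)
  obtain t p where tp: "t \<notin> P" "\<forall>h\<in>insert g G. p h \<in> P"
    "fun_form t * z g = (\<Sum>h\<in>insert g G. fun_form (p h) * z h)"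
    using insert.prems[of g] by blast
  \<comment> \<open>Moving the term \<open>p g\<close> to the left solves the relation for
    \<open>z g\<close>; the coefficient stays outside P because \<open>p g\<close> lies in P and t
    does not.\<close>
  define t0 where "t0 = t - p g"
  have t0: "t0 \<notin> P"
    using P_add[of t0 "p g"] tp(1,2) by (auto simp: t0_def)
  have g: "fun_form t0 * z g = (\<Sum>h\<in>G. fun_form (p h) * z h)"
    using tp(3) insert.hyps by (simp add: t0_def fun_form_diff left_diff_distrib)
  have "\<exists>s. s \<notin> P \<and> (\<forall>g\<in>G. fun_form s * z g = 0)"
  proof (rule insert.IH)
    fix h assume "h \<in> G"
    then obtain t' p' where t': "t' \<notin> P" "\<forall>k\<in>insert g G. p' k \<in> P"
      "fun_form t' * z h = (\<Sum>k\<in>insert g G. fun_form (p' k) * z k)"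
      using insert.prems[of h] by blast
    have "fun_form (t0 * t') * z h = fun_form (p' g) * (fun_form t0 * z g) +
        (\<Sum>k\<in>G. fun_form (t0 * p' k) * z k)"
      using t'(3) insert.hyps fun_form_left_commute[of "fun_form t0" "p' g" "z g"]
      by (simp add: fun_form_mult mult.assoc distrib_left sum_distrib_left)
    also have "\<dots> = (\<Sum>k\<in>G. fun_form (p' g * p k + t0 * p' k) * z k)"
      unfolding g by (simp add: fun_form_add fun_form_mult distrib_right sum.distrib mult.assoc
          sum_distrib_left)
    finally show "\<exists>t p. t \<notin> P \<and> (\<forall>h\<in>G. p h \<in> P) \<and>
        fun_form t * z h = (\<Sum>h\<in>G. fun_form (p h) * z h)"
      using not_mult[OF t0 t'(1)] t'(2)
      by (intro exI[of _ "t0 * t'"] exI[of _ "\<lambda>k. p' g * p k + t0 * p' k"])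
        (simp add: P_add P_mult)
  qed
  then obtain s where s: "s \<notin> P" "\<forall>g\<in>G. fun_form s * z g = 0" by blast
  \<comment> \<open>\<open>t0\<close> expresses \<open>z g\<close> through the remaining elements,
    all of which s kills.\<close>
  have "fun_form (s * t0) * z g = (\<Sum>h\<in>G. fun_form (p h) * (fun_form s * z h))"
    by (simp add: fun_form_mult mult.assoc g sum_distrib_left
        fun_form_left_commute[of "fun_form s" "p _"])
  moreover have "fun_form (s * t0) * z h = 0" if "h \<in> G" for h
    using s(2) that fun_form_left_commute[of "fun_form s" t0 "z h"]
    by (simp add: fun_form_mult mult.assoc)
  ultimately show ?case
    using s(2) not_mult[OF s(1) t0] by (intro exI[of _ "s * t0"]) auto
qed

text \<open>Smoothness makes all fibres of Omega^1 zero, so by Nakayama the differentials of the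
  generators vanish locally at every prime. Their common annihilator therefore lies in no prime and
  contains 1.\<close>

lemma delta_eq_0_if_krull_dim_0:
  assumes smooth: "smooth_affine_algebra TYPE('a::char0_algebra)"
    and dim: "krull_dim TYPE('a) = 0"
  shows "word_form [x :: 'a] = 0"
proof -
  obtain G :: "'a set" where G: "finite G" "subalgebra_generated G = UNIV"
    using smooth unfolding smooth_affine_algebra_def affine_algebra_def by blast
  have local: "\<exists>s. s \<notin> P \<and> (\<forall>g\<in>G. fun_form s * word_form [g] = 0)"
    if P: "prime_ideal P" for P :: "'a set"
  proof (rule nakayama_at_prime[OF G(1) P])
    fix g assume "g \<in> G"
    have "fibre_dim P = 0"
      using smooth P local_dim_le_krull_dim[of P] unfolding smooth_affine_algebra_def dim by simp
    have deg: "word_form [g] \<in> forms_of_degree 1"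
      using word_form_of_degree[of "[g]"] by simp
    \<comment> \<open>A fibre of dimension 0 admits no independent family of length 1, so dg alone
      is dependent there.\<close>
    have "\<not> (\<forall>b s. s \<notin> P \<longrightarrow>
        fun_form s * (\<Sum>i<1. fun_form (b i) * word_form [g]) \<in> ideal_times_forms P \<longrightarrow>
        (\<forall>i<1::nat. b i \<in> P))"
    proof
      assume "\<forall>b s. s \<notin> P \<longrightarrow>
        fun_form s * (\<Sum>i<1. fun_form (b i) * word_form [g]) \<in> ideal_times_forms P \<longrightarrow>
        (\<forall>i<1::nat. b i \<in> P)"
      then have "enat 1 \<le> fibre_dim P"
        unfolding fibre_dim_def using deg
        by (intro Sup_upper CollectI exI[of _ "1 :: nat"] conjI exI[of _ "\<lambda>_. word_form [g]"]) auto
      with \<open>fibre_dim P = 0\<close> show False by (simp add: zero_enat_def)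
    qed
    then obtain b :: "nat \<Rightarrow> 'a" and s where bs: "s \<notin> P" "b 0 \<notin> P"
      "fun_form s * (fun_form (b 0) * word_form [g]) \<in> ideal_times_forms P"
      by auto
    then have "s * b 0 \<notin> P" "fun_form (s * b 0) * word_form [g] \<in> ideal_times_forms P"
      using P by (auto simp: prime_ideal_def fun_form_mult mult.assoc)
    with ideal_times_forms_span_generators[OF G P]
    show "\<exists>t p. t \<notin> P \<and> (\<forall>h\<in>G. p h \<in> P) \<and>
        fun_form t * word_form [g] = (\<Sum>h\<in>G. fun_form (p h) * word_form [h])"
      by blast
  qed
  define I where "I = {a. \<forall>g\<in>G. fun_form a * word_form [g] = 0}"
  have "1 \<in> I"
  proof (rule ccontr)
    assume "1 \<notin> I"
    then have "\<exists>P. prime_ideal P \<and> I \<subseteq> P"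
      by (intro ideal_subset_prime_ideal)
        (auto simp: I_def fun_form_add fun_form_mult distrib_right mult.assoc)
    with local show False by (auto simp: I_def)
  qed
  then have "word_form [g] = 0" if "g \<in> G" for g
    using that by (auto simp: I_def)
  then show ?thesis
    using delta_span_generators[OF G, of x] by auto
qed

lemma delta_mult_volume:
  assumes "smooth_affine_algebra TYPE('a::char0_algebra)" "krull_dim TYPE('a) = enat n"
    and "volume_form n (vol :: 'a form)"
  shows "word_form [x] * vol = 0"
proof (cases "n = 0")
  case True
  then show ?thesis
    using delta_eq_0_if_krull_dim_0[OF assms(1)] assms(2) by (simp add: zero_enat_def)
next
  case False
  then show ?thesis
    using delta_mult_volume_positive_degree[OF assms(3)] by simp
qed

section \<open>Forms on the polynomial extension\<close>

lemma const_0 [simp]: "const 0 = 0"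
  by (simp add: const_def)

lemma const_form_add: "const_form (\<omega> + \<eta>) = const_form \<omega> + const_form \<eta>"
proof (induction \<omega> rule: form.abs_induct, induction \<eta> rule: form.abs_induct)
  fix u v :: "'a list \<Rightarrow>\<^sub>0 'a"
  show "const_form (form_class v + form_class u) =
      const_form (form_class v) + const_form (form_class u)"
    unfolding form_class_hom(1)[symmetric] const_form.abs_eq form_class_extend
    by (rule extend_add) (simp add: form_class_tensor const_hom fun_form_add distrib_right)
qed

lemma const_form_0 [simp]: "const_form 0 = 0"
  by (rule additive_0[OF const_form_add])

lemma const_form_generator:
  "const_form (fun_form b * word_form xs) = fun_form (const b) * word_form (map const xs)"
  unfolding form_class_tensor[symmetric] const_form.abs_eq form_class_extend
  by (subst extend_single)
    (simp_all add: form_class_tensor const_hom fun_form_add distrib_right)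

lemma const_1 [simp]: "const 1 = 1"
  by (simp add: const_def one_pCons)

lemma const_form_word_form: "const_form (word_form xs) = word_form (map const xs)"
  using const_form_generator[of 1 xs] by simp

lemma const_form_fun_mult: "const_form (fun_form a * \<omega>) = fun_form (const a) * const_form \<omega>"
proof (induction \<omega> rule: form_induct)
  case (generator b xs)
  show ?case
    using const_form_generator[of "a * b" xs]
    by (simp add: const_form_generator fun_form_mult mult.assoc const_hom)
qed (simp_all add: const_form_add distrib_left)

lemma const_form_delta_mult: "const_form (word_form [x] * \<omega>) = word_form [const x] * const_form \<omega>"
proof (induction \<omega> rule: form_induct)
  case (generator b xs)
  show ?case
    using delta_mult_generator[of "const x" "const b" "map const xs"]
    by (simp add: const_form_generator delta_mult_generator)
qed (simp_all add: const_form_add distrib_left)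

lemma ext_d_const_form: "ext_d (const_form \<omega>) = const_form (ext_d \<omega>)"
proof (induction \<omega> rule: form_induct)
  case (generator b xs)
  show ?case
    using ext_d_generator[of "const b" "map const xs"]
    by (simp add: const_form_generator ext_d_generator const_form_word_form)
qed (simp_all add: const_form_add ext_d_add)

lemma contraction_const_form_eq_0:
  assumes "derivation D" "\<And>a. D (const a) = 0"
  shows "contraction D (const_form \<omega>) = 0"
proof (induction \<omega> rule: form_induct)
  case (generator b xs)
  have "contraction D (word_form (map const xs)) = 0"
  proof (induction xs)
    case Nil
    show ?case
      by (simp add: contraction_word_form[OF assms(1)] form_class_contract_word
          del: contract_word.simps)
  next
    case (Cons x xs)
    then show ?case
      using contraction_delta_mult[OF assms(1), of "const x" "word_form (map const xs)"]
      by (simp add: word_form_Cons[of "const x" "map const xs"] assms(2))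
  qed
  then show ?case
    by (simp add: const_form_generator contraction_fun_mult)
qed (simp_all add: const_form_add contraction_add)

lemma lie_derivative_const_form_eq_0:
  assumes "derivation D" "\<And>a. D (const a) = 0"
  shows "lie_derivative D (const_form \<omega>) = 0"
  by (simp add: lie_derivative_def ext_d_const_form contraction_const_form_eq_0[OF assms])

text \<open>For a multiple mD the Lie derivative is m times that of D plus dm wedge the contraction
  by D. Each correction term carries a factor \<open>dm_k\<close>, which \<open>\<theta>\<close>
  annihilates.\<close>

lemma lie_derivative_const_form:
  fixes H :: "'a::char0_algebra poly poly \<Rightarrow> 'a poly poly"
    and K :: "'k set"
  assumes H: "derivation H" "\<And>a. H (const a) = (\<Sum>k\<in>K. m k * const (D k a))"
    and D: "\<And>k. k \<in> K \<Longrightarrow> derivation (D k)"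
    and \<theta>: "\<And>k. k \<in> K \<Longrightarrow> word_form [m k] * \<theta> = 0"
  shows "lie_derivative H (const_form \<omega>) * \<theta> =
    (\<Sum>k\<in>K. fun_form (m k) * (const_form (lie_derivative (D k) \<omega>) * \<theta>))"
proof -
  have sum_fun: "fun_form (sum f K) = (\<Sum>k\<in>K. fun_form (f k))" for f :: "'k \<Rightarrow> 'a poly poly"
    by (induction K rule: infinite_finite_induct) (simp_all add: fun_form_add)
  have sum_delta: "word_form [sum f K] = (\<Sum>k\<in>K. word_form [f k])" for f :: "'k \<Rightarrow> 'a poly poly"
    using additive_0[of "\<lambda>a. word_form [a]", OF delta_add]
    by (induction K rule: infinite_finite_induct) (simp_all add: delta_add)
  have word: "lie_derivative H (word_form (map const xs)) * \<theta> =
      (\<Sum>k\<in>K. fun_form (m k) * (const_form (lie_derivative (D k) (word_form xs)) * \<theta>))" for xs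
  proof (induction xs)
    case Nil
    show ?case
      by (simp add: lie_derivative_word_Nil[OF H(1)] lie_derivative_word_Nil[OF D])
  next
    case (Cons x xs)
    let ?w = "word_form (map const xs)"
    \<comment> \<open>\<open>dm_k\<close> passes the word at the cost of a sign and then meets
      \<open>\<theta>\<close>.\<close>
    have kill: "word_form [m k] * (?w * \<theta>) = 0" if "k \<in> K" for k
      using delta_word_commute[of "m k" "map const xs"] \<theta>[OF that]
      by (simp add: mult.assoc[symmetric]) (simp add: mult.assoc)
    have "word_form [H (const x)] * ?w * \<theta> =
        (\<Sum>k\<in>K. fun_form (m k) * (word_form [const (D k x)] * (?w * \<theta>)))"
      unfolding H(2) sum_delta sum_distrib_right
      by (rule sum.cong)
        (simp_all add: delta_mult distrib_right mult.assoc kill)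
    moreover have "word_form [const x] * lie_derivative H ?w * \<theta> =
        (\<Sum>k\<in>K. fun_form (m k) *
          (word_form [const x] * (const_form (lie_derivative (D k) (word_form xs)) * \<theta>)))"
      unfolding mult.assoc Cons sum_distrib_left
      by (rule sum.cong) (simp_all add: fun_form_left_commute[of "word_form _"])
    moreover have "lie_derivative H (word_form (map const (x # xs))) =
        word_form [H (const x)] * ?w + word_form [const x] * lie_derivative H ?w"
      using lie_derivative_delta_mult[OF H(1), of "const x" ?w]
      by (simp add: word_form_Cons[of "const x" "map const xs"])
    moreover have "const_form (lie_derivative (D k) (word_form (x # xs))) =
        word_form [const (D k x)] * ?w +
        word_form [const x] * const_form (lie_derivative (D k) (word_form xs))"
      if "k \<in> K" for k
      by (simp add: word_form_Cons[of x xs] lie_derivative_delta_mult[OF D[OF that]]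
          const_form_add const_form_delta_mult const_form_word_form)
    ultimately show ?case
      by (simp add: distrib_right distrib_left mult.assoc sum.distrib)
  qed
  show ?thesis
  proof (induction \<omega> rule: form_induct)
    case zero
    show ?case by simp
  next
    case (generator b xs)
    have "fun_form (H (const b)) * (word_form (map const xs) * \<theta>) =
        (\<Sum>k\<in>K. fun_form (m k) * (fun_form (const (D k b)) * (word_form (map const xs) * \<theta>)))"
      by (simp add: H(2) sum_fun sum_distrib_right fun_form_mult mult.assoc)
    moreover have "fun_form (const b) * (lie_derivative H (word_form (map const xs)) * \<theta>) =
        (\<Sum>k\<in>K. fun_form (m k) *
          (fun_form (const b) * (const_form (lie_derivative (D k) (word_form xs)) * \<theta>)))"
      unfolding word sum_distrib_left
      by (rule sum.cong) (simp_all add: fun_form_left_commute[of "fun_form (const b)" "m _"])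
    moreover have "const_form (lie_derivative (D k) (fun_form b * word_form xs)) =
        fun_form (const (D k b)) * word_form (map const xs) +
        fun_form (const b) * const_form (lie_derivative (D k) (word_form xs))" if "k \<in> K" for k
      by (simp add: lie_derivative_fun_mult[OF D[OF that]] const_form_add const_form_fun_mult
          const_form_word_form)
    ultimately show ?case
      by (simp add: const_form_generator lie_derivative_fun_mult[OF H(1)] distrib_right
          distrib_left mult.assoc sum.distrib)
  next
    case (add \<omega> \<eta>)
    then show ?case
      by (simp add: const_form_add lie_derivative_add distrib_right distrib_left sum.distrib)
  qed
qed

section \<open>Partial derivatives of R[y1, y2]\<close>

lemma derivationI:
  assumes "\<And>a b. D (a + b) = D a + D b" "\<And>a b. D (a * b) = a * D b + b * D a"
    and "\<And>c. c \<in> scalars \<Longrightarrow> D c = 0"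
  shows "derivation D"
  unfolding derivation_def k_linear_def by (simp add: assms)

text \<open>The library's \<open>pderiv\<close> requires coefficients without zero divisors.\<close>

lift_definition formal_deriv :: "'a::comm_semiring_1 poly \<Rightarrow> 'a poly" is
  "\<lambda>c n. of_nat (Suc n) * c (Suc n)"
proof -
  fix c :: "nat \<Rightarrow> 'a"
  assume "\<forall>\<^sub>\<infinity>n. c n = 0"
  then have "\<forall>\<^sub>\<infinity>n. c (Suc n) = 0" by (rule iffD2[OF MOST_Suc_iff])
  then show "\<forall>\<^sub>\<infinity>n. of_nat (Suc n) * c (Suc n) = 0"
    by (rule MOST_mono) simp
qed

lemma coeff_formal_deriv: "coeff (formal_deriv p) n = of_nat (Suc n) * coeff p (Suc n)"
  by (simp add: formal_deriv.rep_eq)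

lemma formal_deriv_0 [simp]: "formal_deriv 0 = 0"
  by (rule poly_eqI) (simp add: coeff_formal_deriv)

lemma formal_deriv_pCons: "formal_deriv (pCons a p) = p + pCons 0 (formal_deriv p)"
  by (rule poly_eqI) (auto simp: coeff_formal_deriv coeff_pCons algebra_simps split: nat.split)

lemma formal_deriv_add: "formal_deriv (p + q) = formal_deriv p + formal_deriv q"
  by (rule poly_eqI) (simp add: coeff_formal_deriv algebra_simps)

lemma formal_deriv_smult: "formal_deriv (smult a p) = smult a (formal_deriv p)"
  by (rule poly_eqI) (simp add: coeff_formal_deriv algebra_simps)

lemma formal_deriv_mult: "formal_deriv (p * q) = p * formal_deriv q + q * formal_deriv p"
  by (induction p)
    (simp_all add: formal_deriv_pCons formal_deriv_add formal_deriv_smult algebra_simps)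

text \<open>\<open>y1\<close> is the inner variable of R[y1][y2], so differentiation acts on the
  coefficients of the outer polynomial.\<close>

definition partial1 :: "'a::comm_ring_1 poly poly \<Rightarrow> 'a poly poly" where
  "partial1 = map_poly formal_deriv"

definition partial2 :: "'a::comm_ring_1 poly poly \<Rightarrow> 'a poly poly" where
  "partial2 = formal_deriv"

lemma coeff_partial1: "coeff (partial1 p) n = formal_deriv (coeff p n)"
  by (simp add: partial1_def coeff_map_poly)

lemma partial_const [simp]: "partial1 (const a) = 0" "partial2 (const a) = 0"
  by (simp_all add: partial1_def partial2_def const_def map_poly_pCons formal_deriv_pCons)

lemma partial_y [simp]: "partial1 y1 = 1" "partial1 y2 = 0" "partial2 y1 = 0" "partial2 y2 = 1"
  by (simp_all add: partial1_def partial2_def y1_def y2_def map_poly_pCons formal_deriv_pCons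
      one_pCons)

lemma partial_scalar:
  assumes "c \<in> scalars"
  shows "partial1 c = 0" "partial2 c = 0"
  using assms partial_const unfolding scalars_poly_def const_def by auto

lemma partial1_add: "partial1 (p + q) = partial1 p + partial1 q"
  by (rule poly_eqI) (simp add: coeff_partial1 formal_deriv_add)

lemma formal_deriv_sum: "formal_deriv (sum f A) = (\<Sum>x\<in>A. formal_deriv (f x))"
  by (induction A rule: infinite_finite_induct) (simp_all add: formal_deriv_add)

lemma partial1_mult: "partial1 (p * q) = p * partial1 q + q * partial1 p"
proof -
  have "formal_deriv (a * b) = a * formal_deriv b + formal_deriv a * b" for a b :: "'a poly"
    by (simp add: formal_deriv_mult mult.commute)
  then have "partial1 (p * q) = p * partial1 q + partial1 p * q"
    by (intro poly_eqI)
      (simp add: coeff_partial1 coeff_mult formal_deriv_sum sum.distrib)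
  then show ?thesis by (simp add: mult.commute)
qed

lemma derivation_partial:
  "derivation (partial1 :: 'a::char0_algebra poly poly \<Rightarrow> _)"
  "derivation (partial2 :: 'a::char0_algebra poly poly \<Rightarrow> _)"
  by (auto intro!: derivationI partial1_add partial1_mult partial_scalar)
    (simp_all add: partial2_def formal_deriv_add formal_deriv_mult)

lemma of_nat_in_scalars: "of_nat m \<in> (scalars :: 'a::char0_algebra set)"
proof (induction m)
  case 0
  show ?case using diff_in_scalars[OF one_in_scalars one_in_scalars] by simp
next
  case (Suc m)
  have "(0 :: 'a) \<in> scalars" using diff_in_scalars[OF one_in_scalars one_in_scalars] by simp
  \<comment> \<open>The scalars are closed under differences, and m + 1 = m - (0 - 1).\<close>
  from diff_in_scalars[OF Suc diff_in_scalars[OF this one_in_scalars]]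
  show ?case by (simp add: add.commute)
qed

text \<open>A positive integer is a nonzero scalar, hence a unit. Thus differentiation loses no
  coefficient of positive degree, even when R has zero divisors.\<close>

lemma of_nat_mult_eq_0:
  assumes "of_nat (Suc m) * a = (0 :: 'a::char0_algebra)"
  shows "a = 0"
proof -
  obtain c :: 'a where c: "of_nat (Suc m) * c = 1"
    using inverse_in_scalars[OF of_nat_in_scalars[of "Suc m"]] of_nat_neq_0 by blast
  have "a = c * (of_nat (Suc m) * a)"
    using c by (metis mult.assoc mult.commute mult.left_neutral)
  with assms show ?thesis by simp
qed

section \<open>Evaluation at the origin and injectivity of coefficients\<close>

definition eval_0 :: "'a::comm_ring_1 poly poly \<Rightarrow> 'a" where
  "eval_0 p = coeff (coeff p 0) 0"

lemma eval_0_hom: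
  "eval_0 (a + b) = eval_0 a + eval_0 b"
  "eval_0 (a * b) = eval_0 a * eval_0 b"
  "eval_0 (const c) = c"
  "k \<in> scalars \<Longrightarrow> eval_0 k \<in> scalars"
  by (auto simp: eval_0_def const_def scalars_poly_def coeff_mult_0)

text \<open>The map on forms induced by the algebra map R[y1, y2] -> R sending both variables to 0;
  it is a left inverse of \<open>const_form\<close>.\<close>

lift_definition eval_form :: "'a::char0_algebra poly poly form \<Rightarrow> 'a form" is
  "extend (\<lambda>xs b. tensor (eval_0 b) (map eval_0 xs))"
proof -
  fix u v :: "'a poly poly list \<Rightarrow>\<^sub>0 'a poly poly"
  assume rel: "form_rel u v"
  let ?g = "\<lambda>xs b. fun_form (eval_0 b) * word_form (map eval_0 xs)"
  have "extend ?g u = extend ?g v"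
  proof (rule extend_respects_form_rel[OF _ _ _ _ _ rel])
    fix xs ys :: "'a poly poly list" and f a b :: "'a poly poly"
    show "?g (xs @ [a + b] @ ys) f = ?g (xs @ [a] @ ys) f + ?g (xs @ [b] @ ys) f"
      by (simp only: map_append list.map word_form_split eval_0_hom delta_add distrib_left
          distrib_right)
    show "?g (xs @ [a * b] @ ys) f = ?g (xs @ [b] @ ys) (f * a) + ?g (xs @ [a] @ ys) (f * b)"
      by (simp only: map_append list.map word_form_split eval_0_hom delta_mult distrib_left
          distrib_right fun_form_mult mult.assoc fun_form_left_commute[of "word_form _"])
  next
    fix xs ys :: "'a poly poly list" and f c :: "'a poly poly"
    assume "c \<in> scalars"
    then show "?g (xs @ [c] @ ys) f = 0"
      by (simp only: map_append list.map word_form_split eval_0_hom delta_scalar mult_zero_left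
          mult_zero_right)
  next
    fix xs ys :: "'a poly poly list" and f a :: "'a poly poly"
    have "word_form ([eval_0 a, eval_0 a] @ map eval_0 ys) = 0"
      using word_form_append[of "[eval_0 a]" "[eval_0 a]"]
        word_form_append[of "[eval_0 a, eval_0 a]" "map eval_0 ys"]
      by (simp add: delta_square)
    then show "?g (xs @ [a, a] @ ys) f = 0"
      by (simp add: word_form_append[of "map eval_0 xs"])
  qed (simp add: eval_0_hom fun_form_add distrib_right)
  then show "form_rel (extend (\<lambda>xs b. tensor (eval_0 b) (map eval_0 xs)) u)
      (extend (\<lambda>xs b. tensor (eval_0 b) (map eval_0 xs)) v)"
    by (simp add: form_class_eq_iff[symmetric] form_class_extend form_class_tensor)
qed

lemma eval_form_add: "eval_form (\<omega> + \<eta>) = eval_form \<omega> + eval_form \<eta>"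
proof (induction \<omega> rule: form.abs_induct, induction \<eta> rule: form.abs_induct)
  fix u v :: "'a poly poly list \<Rightarrow>\<^sub>0 'a poly poly"
  show "eval_form (form_class v + form_class u) =
      eval_form (form_class v) + eval_form (form_class u)"
    unfolding form_class_hom(1)[symmetric] eval_form.abs_eq form_class_extend
    by (rule extend_add) (simp add: form_class_tensor eval_0_hom fun_form_add distrib_right)
qed

lemma eval_form_0 [simp]: "eval_form 0 = 0"
  by (rule additive_0[OF eval_form_add])

lemma eval_form_generator:
  "eval_form (fun_form b * word_form xs) = fun_form (eval_0 b) * word_form (map eval_0 xs)"
  unfolding form_class_tensor[symmetric] eval_form.abs_eq form_class_extend
  by (subst extend_single)
    (simp_all add: form_class_tensor eval_0_hom fun_form_add distrib_right)

lemma eval_form_const_form: "eval_form (fun_form g * const_form \<omega>) = fun_form (eval_0 g) * \<omega>"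
proof (induction \<omega> rule: form_induct)
  case (generator b xs)
  have "map (eval_0 \<circ> const) xs = xs"
    by (rule map_idI) (simp add: eval_0_hom)
  then show ?case
    using eval_form_generator[of "g * const b" "map const xs"]
    by (simp add: const_form_generator fun_form_mult mult.assoc eval_0_hom)
qed (simp_all add: const_form_add eval_form_add distrib_left)

text \<open>The annihilator of \<open>vol\<close> in \<open>R[y\<^sub>1, y\<^sub>2]\<close> is closed under both partial derivatives, so that
  every coefficient of an annihilating polynomial shows up as a value at the origin.\<close>

lemma const_form_volume_coeff_unique:
  assumes vol: "volume_form n vol" and g: "fun_form g * const_form vol = 0"
  shows "g = 0"
proof -
  \<comment> \<open>An R-linear derivation has zero Lie derivative on \<open>const_form vol\<close>,
    so differentiating the relation leaves only the term with \<open>D g\<close>.\<close>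
  have partial: "fun_form (D g) * const_form vol = 0"
    if "derivation D" "\<And>a. D (const a) = 0" "fun_form g * const_form vol = 0" for D g
    using lie_derivative_fun_mult[OF that(1), of g "const_form vol"]
    by (simp add: lie_derivative_const_form_eq_0[OF that(1,2)] that(3))
  have "coeff (coeff g j) i = 0" if "fun_form g * const_form vol = 0" for g i j
    using that
  proof (induction "i + j" arbitrary: i j g)
    case 0
    have "fun_form (eval_0 g) * vol = fun_form 0 * vol"
      using eval_form_const_form[of g vol] by (simp add: 0)
    from volume_form_coeff_unique[OF vol this] show ?case
      using 0 by (simp add: eval_0_def)
  next
    case (Suc m)
    show ?case
    proof (cases j)
      case (Suc j')
      \<comment> \<open>Differentiation lowers the total degree i + j of the inspected coefficient
        by one, at the price of the integer factor \<open>Suc j'\<close>.\<close>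
      have "coeff (coeff (partial2 g) j') i = 0"
        using Suc.hyps \<open>j = Suc j'\<close> Suc.prems
        by (intro Suc.hyps(1)) (simp_all add: partial derivation_partial)
      then have "of_nat (Suc j') * coeff (coeff g (Suc j')) i = 0"
        by (simp add: partial2_def coeff_formal_deriv del: of_nat_Suc)
          (metis coeff_smult of_nat_mult_conv_smult)
      then show ?thesis
        using of_nat_mult_eq_0 \<open>j = Suc j'\<close> by blast
    next
      case 0
      then obtain i' where i: "i = Suc i'" "m = i' + j" using Suc.hyps(2) by (cases i) auto
      have "coeff (coeff (partial1 g) j) i' = 0"
        using Suc.prems by (intro Suc.hyps(1)[OF i(2)]) (simp add: partial derivation_partial)
      then have "of_nat (Suc i') * coeff (coeff g j) i = 0"
        by (simp add: coeff_partial1 coeff_formal_deriv i del: of_nat_Suc)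
      then show ?thesis
        by (rule of_nat_mult_eq_0)
    qed
  qed
  with g show ?thesis by (simp add: poly_eq_iff)
qed

section \<open>Coefficients of the extended volume form\<close>

text \<open>A product of two differentials has even degree and is central. Pulling it to the front
  exposes dy1 and dy2 to the rules for a leading differential.\<close>

lemma delta_delta_commute:
  "\<omega> * (word_form [a] * word_form [b]) = word_form [a] * (word_form [b] * \<omega>)"
proof (induction \<omega> rule: form_induct)
  case (generator f xs)
  have "word_form xs * (word_form [a] * word_form [b]) =
      word_form [a] * (word_form [b] * word_form xs)"
    unfolding delta_word_commute[of b xs]
    by (simp add: mult.assoc[symmetric] delta_word_commute[of a xs])
  then show ?case
    by (simp add: mult.assoc fun_form_left_commute[of "word_form _"])
qed (simp_all add: distrib_left distrib_right)

lemma extended_volume_eq: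
  "extended_volume vol = word_form [y1] * (word_form [y2] * const_form vol)"
  by (simp add: extended_volume_def ext_d_fun_form mult.assoc delta_delta_commute)

lemma extended_volume_coeff_unique:
  assumes vol: "volume_form n vol"
    and eq: "fun_form g * extended_volume vol = fun_form h * extended_volume vol"
  shows "g = h"
proof -
  let ?\<eta> = "fun_form (g - h) * const_form vol"
  have contract: "contraction partial1 ?\<eta> = 0" "contraction partial2 ?\<eta> = 0"
    by (simp_all add: contraction_fun_mult contraction_const_form_eq_0 derivation_partial)
  have "word_form [y1] * (word_form [y2] * ?\<eta>) = 0"
    using eq by (simp add: extended_volume_eq fun_form_left_commute[of "word_form _"]
        fun_form_diff left_diff_distrib right_diff_distrib)
  \<comment> \<open>Contraction by the first partial derivative kills dy2 and the rest, and strips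
    off dy1 with coefficient 1; the second one then removes dy2.\<close>
  from arg_cong[OF this, of "contraction partial1"] have "word_form [y2] * ?\<eta> = 0"
    by (simp add: contraction_delta_mult derivation_partial contract)
  from arg_cong[OF this, of "contraction partial2"] have "?\<eta> = 0"
    by (simp add: contraction_delta_mult derivation_partial contract)
  from const_form_volume_coeff_unique[OF vol this] show ?thesis by simp
qed

section \<open>The modular derivation\<close>

text \<open>dg is a combination of dy1, dy2 and differentials from R, and \<open>vol\<close> absorbs
  the latter. The set of such g contains R and both variables and is closed under sums and
  products.\<close>

lemma delta_mult_const_form_volume:
  fixes g :: "'a::char0_algebra poly poly"
  assumes "\<And>x. word_form [x] * vol = 0"
  shows "word_form [g] * const_form vol =
    fun_form (partial1 g) * (word_form [y1] * const_form vol) +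
    fun_form (partial2 g) * (word_form [y2] * const_form vol)"
    (is "?P g")
proof -
  have const: "?P (const a)" for a
    by (simp add: const_form_delta_mult[symmetric] assms)
  have y: "?P y1" "?P y2"
    by simp_all
  have add: "?P (a + b)" if "?P a" "?P b" for a b
    by (simp only: delta_add distrib_right that derivationD(1)[OF derivation_partial(1)]
        derivationD(1)[OF derivation_partial(2)] fun_form_add add.assoc add.left_commute)
  have mult: "?P (a * b)" if "?P a" "?P b" for a b
    by (simp add: delta_mult distrib_right distrib_left mult.assoc that fun_form_mult
        derivationD(2)[OF derivation_partial(1)] derivationD(2)[OF derivation_partial(2)]
        fun_form_add add.assoc add.left_commute)
  have inner: "?P [:p:]" for p
  proof (induction p)
    case 0
    show ?case using const[of 0] by simp
  next
    case (pCons a p)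
    have "[:pCons a p:] = const a + y1 * [:p:]" by (simp add: const_def y1_def)
    then show ?case using add[OF const mult[OF y(1) pCons.IH]] by (simp only:)
  qed
  show ?thesis
  proof (induction g)
    case 0
    show ?case using const[of 0] by simp
  next
    case (pCons p g)
    have "pCons p g = [:p:] + y2 * g" by (simp add: y2_def)
    then show ?case using add[OF inner mult[OF y(2) pCons.IH]] by (simp only:)
  qed
qed

text \<open>The product rule gives three summands. Differentiating \<open>vol\<close> yields the
  terms with a, b, c; differentiating dy1 and dy2 yields the divergence of H in the
  y-directions.\<close>

lemma lie_derivative_extended_volume:
  fixes H :: "'a::char0_algebra poly poly \<Rightarrow> 'a poly poly"
  assumes top: "\<And>x. word_form [x] * vol = 0"
    and H: "derivation H"
      "\<And>a. H (const a) = const (A a) * y1 + const (B a) * y2 + const (C a)"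
    and derivations: "derivation A" "derivation B" "derivation C"
    and lie: "lie_derivative A vol = fun_form a * vol" "lie_derivative B vol = fun_form b * vol"
      "lie_derivative C vol = fun_form c * vol"
  shows "lie_derivative H (extended_volume vol) =
    fun_form (const a * y1 + const b * y2 + const c + partial1 (H y1) + partial2 (H y2)) *
      extended_volume vol"
proof -
  \<comment> \<open>The multipliers \<open>y1\<close>, \<open>y2\<close>, 1 are paired with A, B, C;
    their differentials dy1, dy2, 0 are all killed by dy1 dy2.\<close>
  define m :: "nat \<Rightarrow> 'a poly poly"
    where "m k = (if k = 0 then y1 else if k = 1 then y2 else 1)" for k
  define D where "D k = (if k = 0 then A else if k = 1 then B else C)" for k :: nat
  let ?\<theta> = "word_form [y1] * word_form [y2] :: 'a poly poly form"
  have squares: "word_form [y1] * (word_form [y1] * \<omega>) = 0"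
    "word_form [y2] * (word_form [y2] * \<omega>) = 0"
    "word_form [y2] * (word_form [y1] * \<omega>) = - (word_form [y1] * (word_form [y2] * \<omega>))"
    for \<omega> :: "'a poly poly form"
    by (simp_all only: mult.assoc[symmetric] delta_square delta_anticommute[of y2 y1]
        mult_minus_left mult_zero_left)
  have "lie_derivative H (const_form vol) * ?\<theta> =
      (\<Sum>k\<in>{0, 1, 2}. fun_form (m k) * (const_form (lie_derivative (D k) vol) * ?\<theta>))"
  proof (rule lie_derivative_const_form[OF H(1)])
    show "H (const x) = (\<Sum>k\<in>{0, 1, 2}. m k * const (D k x))" for x
      by (simp add: H(2) m_def D_def mult.commute add.assoc)
    show "derivation (D k)" for k
      by (simp add: D_def derivations)
    show "word_form [m k] * ?\<theta> = 0" for k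
      using squares(1)[of "word_form [y2]"] squares(3)[of "word_form [y2]"]
      by (simp add: m_def delta_square)
  qed
  also have "\<dots> = fun_form (const a * y1 + const b * y2 + const c) * extended_volume vol"
    by (simp add: m_def D_def lie const_form_fun_mult delta_delta_commute extended_volume_eq
        mult.assoc fun_form_add fun_form_mult distrib_right
        fun_form_left_commute[of "word_form _"]
        fun_form_left_commute[of "fun_form y1" "const a"]
        fun_form_left_commute[of "fun_form y2" "const b"] add.assoc)
  finally have "word_form [y1] * (word_form [y2] * lie_derivative H (const_form vol)) =
      fun_form (const a * y1 + const b * y2 + const c) * extended_volume vol"
    by (simp add: delta_delta_commute)
  \<comment> \<open>Beside dy1 only the dy2-component of d(H y2) survives.\<close>
  moreover have "word_form [y1] * (word_form [H y2] * const_form vol) =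
      fun_form (partial2 (H y2)) * extended_volume vol"
    by (simp add: delta_mult_const_form_volume[OF top, of "H y2"] distrib_left extended_volume_eq
        fun_form_left_commute[of "word_form _"] squares)
  \<comment> \<open>With dy2 moved to the front only the dy1-component of d(H y1) survives;
    restoring the order dy1 dy2 cancels the sign.\<close>
  moreover have "word_form [H y1] * (word_form [y2] * const_form vol) =
      - (word_form [y2] * (word_form [H y1] * const_form vol))"
    by (simp add: mult.assoc[symmetric] delta_anticommute[of "H y1"])
  then have "word_form [H y1] * (word_form [y2] * const_form vol) =
      fun_form (partial1 (H y1)) * extended_volume vol"
    by (simp add: delta_mult_const_form_volume[OF top, of "H y1"] distrib_left extended_volume_eq
        fun_form_left_commute[of "word_form _"] squares)
  ultimately show ?thesis
    by (simp add: extended_volume_eq lie_derivative_delta_mult[OF H(1)] distrib_left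
        distrib_right fun_form_add add.assoc add.left_commute add.commute)
qed

section \<open>Hamiltonian derivations of the double extension\<close>

lemma modular_derivationI:
  assumes "lie_derivative (br f) vol = fun_form g * vol"
    and "\<And>g h. fun_form g * vol = fun_form h * vol \<Longrightarrow> g = h"
  shows "modular_derivation br vol f = g"
  unfolding modular_derivation_def using assms by (intro the_equality) auto

lemma affine_coeff_eq:
  assumes "const a * y1 + const b * y2 + const c = const a' * y1 + const b' * y2 + const c'"
  shows "a = a'" "b = b'" "c = c'"
  using assms by (simp_all add: const_def y1_def y2_def)

text \<open>Expanding the bracket of \<open>y_i\<close> with ab by the Leibniz rule and comparing
  the coefficients of \<open>y1\<close>, \<open>y2\<close> and 1 gives the three Leibniz
  rules.\<close>

lemma poisson_double_extension_derivations:
  fixes brS :: "'a::char0_algebra poly poly \<Rightarrow> 'a poly poly \<Rightarrow> 'a poly poly"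
  assumes "poisson_double_extension brR q11 q12 \<alpha> \<nu> w1 w2 w0 brS" "i \<in> {1, 2}"
  shows "derivation (\<alpha> i 1)" "derivation (\<alpha> i 2)" "derivation (\<nu> i)"
proof -
  define y :: "'a poly poly" where "y = (if i = 1 then y1 else y2)"
  have lin: "k_linear (\<alpha> i 1)" "k_linear (\<alpha> i 2)" "k_linear (\<nu> i)"
    using assms unfolding poisson_double_extension_def by auto
  have br: "brS y (const a) = const (\<alpha> i 1 a) * y1 + const (\<alpha> i 2 a) * y2 + const (\<nu> i a)" for a
    using assms unfolding poisson_double_extension_def y_def by auto
  have "derivation (brS y)"
    using assms(1) unfolding poisson_double_extension_def poisson_bracket_def by blast
  then have "brS y (const a * const b) = const a * brS y (const b) + const b * brS y (const a)"
    for a b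
    by (rule derivationD)
  then have "const (\<alpha> i 1 (a * b)) * y1 + const (\<alpha> i 2 (a * b)) * y2 + const (\<nu> i (a * b)) =
      const (a * \<alpha> i 1 b + b * \<alpha> i 1 a) * y1 + const (a * \<alpha> i 2 b + b * \<alpha> i 2 a) * y2 +
      const (a * \<nu> i b + b * \<nu> i a)" for a b
    unfolding const_hom(2)[symmetric] br by (simp add: const_hom algebra_simps)
  from affine_coeff_eq[OF this] lin
  show "derivation (\<alpha> i 1)" "derivation (\<alpha> i 2)" "derivation (\<nu> i)"
    by (simp_all add: derivation_def)
qed

lemma poisson_bracket_antisym:
  assumes "poisson_bracket br"
  shows "br a b = - br b a"
proof -
  have add: "br x (y + z) = br x y + br x z" "br (y + z) x = br y x + br z x" and self: "br x x = 0"
    for x y z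
    using assms unfolding poisson_bracket_def k_linear_def by blast+
  have "br a b + br b a = br (a + b) (a + b)"
    unfolding add by (simp add: self)
  also have "\<dots> = 0" by (rule self)
  finally show ?thesis by (simp add: eq_neg_iff_add_eq_0)
qed

lemma derivation_zero: "derivation (\<lambda>_. 0)"
  by (simp add: derivation_def k_linear_def)

lemma contraction_zero: "contraction (\<lambda>_. 0) \<omega> = 0"
proof (induction \<omega> rule: form_induct)
  case (generator b xs)
  have "contraction (\<lambda>_. 0) (word_form xs) = 0"
  proof (induction xs)
    case Nil
    show ?case
      by (simp add: contraction_word_form[OF derivation_zero] form_class_contract_word
          del: contract_word.simps)
  next
    case (Cons x xs)
    then show ?case
      by (simp add: word_form_Cons[of x xs] contraction_delta_mult[OF derivation_zero])
  qed
  then show ?case by (simp add: contraction_fun_mult)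
qed (simp_all add: contraction_add)

lemma lie_derivative_zero: "lie_derivative (\<lambda>_. 0) \<omega> = 0"
  by (simp add: lie_derivative_def contraction_zero)

theorem theorem3p5:
  fixes brR :: "'a::char0_algebra \<Rightarrow> 'a \<Rightarrow> 'a"
    and brS :: "'a poly poly \<Rightarrow> 'a poly poly \<Rightarrow> 'a poly poly"
    and n :: nat
    and vol :: "'a form"
    and q11 q12 w1 w2 w0 :: 'a
    and \<alpha> :: "nat \<Rightarrow> nat \<Rightarrow> 'a \<Rightarrow> 'a"
    and \<nu> :: "nat \<Rightarrow> 'a \<Rightarrow> 'a"
    and \<phi> :: "'a \<Rightarrow> 'a"
    and \<psi> :: "'a poly poly \<Rightarrow> 'a poly poly"
    and u :: "nat \<Rightarrow> nat \<Rightarrow> 'a"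
    and v :: "nat \<Rightarrow> 'a"
  assumes "smooth_affine_algebra TYPE('a)"
    and "krull_dim TYPE('a) = enat n"
    and "poisson_bracket brR"
    and "volume_form n vol"
    and "poisson_double_extension brR q11 q12 \<alpha> \<nu> w1 w2 w0 brS"
    and "\<phi> = modular_derivation brR vol"
    and "\<psi> = modular_derivation brS (extended_volume vol)"
    and "\<forall>i\<in>{1, 2}. \<forall>j\<in>{1, 2}. lie_derivative (\<alpha> i j) vol = u i j *\<^sub>\<Omega> vol"
    and "\<forall>i\<in>{1, 2}. lie_derivative (\<nu> i) vol = v i *\<^sub>\<Omega> vol"
  shows "(\<forall>a. \<psi> (const a) = const (\<phi> a - \<alpha> 1 1 a - \<alpha> 2 2 a)) \<and>
    \<psi> y1 = const (u 1 1 - q12) * y1 + const (u 1 2) * y2 + const (v 1 - w2) \<and>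
    \<psi> y2 = const (u 2 1 + 2 * q11) * y1 + const (u 2 2 + q12) * y2 + const (v 2 + w1)"
proof -
  note top = delta_mult_volume[OF assms(1,2,4)]
  have br: "poisson_bracket brS"
    "\<And>a b. brS (const a) (const b) = const (brR a b)"
    "brS y2 y1 = const q11 * y1\<^sup>2 + const q12 * y1 * y2 + const w1 * y1 + const w2 * y2 + const w0"
    "\<And>a. brS y1 (const a) = const (\<alpha> 1 1 a) * y1 + const (\<alpha> 1 2 a) * y2 + const (\<nu> 1 a)"
    "\<And>a. brS y2 (const a) = const (\<alpha> 2 1 a) * y1 + const (\<alpha> 2 2 a) * y2 + const (\<nu> 2 a)"
    using assms(5) unfolding poisson_double_extension_def by blast+
  note antisym = poisson_bracket_antisym[OF br(1)]
  have self: "brS f f = 0" and der: "derivation (brS f)" for f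
    using br(1) unfolding poisson_bracket_def by blast+
  have der_R: "derivation (brR a)" for a
    using assms(3) unfolding poisson_bracket_def by blast
  \<comment> \<open>Uniqueness of coefficients reduces each value of \<open>\<psi>\<close> to a
    formula for a Lie derivative of the extended volume.\<close>
  note \<psi> = modular_derivationI[of brS _ "extended_volume vol",
      OF _ extended_volume_coeff_unique[OF assms(4)], folded assms(7)]
  note lie = lie_derivative_extended_volume[OF top der]
  note ders = poisson_double_extension_derivations[OF assms(5)]
  note partial_simps = derivationD(1,2)[OF derivation_partial(1)]
    derivationD(1,2)[OF derivation_partial(2)] derivation_uminus[OF derivation_partial(1)]
    derivation_uminus[OF derivation_partial(2)] derivation_diff[OF derivation_partial(1)]
    derivation_diff[OF derivation_partial(2)] derivation_0[OF derivation_partial(1)]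
    derivation_0[OF derivation_partial(2)]
  have const_2: "const (2 :: 'a) = 2"
    using const_hom(1)[of 1 1] by simp
  have const_diff: "const (a - b) = const a - const b" for a b :: 'a
    by (simp add: const_def)
  have "\<psi> (const a) = const (\<phi> a - \<alpha> 1 1 a - \<alpha> 2 2 a)" for a
  proof -
    have "lie_derivative (brR a) vol \<in> forms_of_degree n"
      using lie_derivative_of_degree[OF der_R] assms(4) by (simp add: volume_form_def)
    then obtain g where g: "lie_derivative (brR a) vol = fun_form g * vol"
      using assms(4) unfolding volume_form_def by blast
    then have "\<phi> a = g"
      unfolding assms(6) using volume_form_coeff_unique[OF assms(4)]
      by (rule modular_derivationI)
    \<comment> \<open>By antisymmetry the \<open>y1\<close>-coefficient of {a, y1} is
      \<open>- \<alpha> 1 1 a\<close>, and likewise for \<open>y2\<close>; this is the whole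
      divergence of the Hamiltonian derivation of a.\<close>
    have "partial1 (brS (const a) y1) = - const (\<alpha> 1 1 a)"
      "partial2 (brS (const a) y2) = - const (\<alpha> 2 2 a)"
      unfolding antisym[of "const a"] br by (simp_all add: partial_simps)
    \<comment> \<open>On R this derivation has no \<open>y1\<close>- or \<open>y2\<close>-part, so
      the zero derivation fills both places and contributes the coefficients 0.\<close>
    moreover have "brS (const a) (const b) = const 0 * y1 + const 0 * y2 + const (brR a b)" for b
      by (simp add: br(2))
    note lie[OF this derivation_zero derivation_zero der_R, of 0 0 g]
    ultimately have "lie_derivative (brS (const a)) (extended_volume vol) =
        fun_form (const (\<phi> a - \<alpha> 1 1 a - \<alpha> 2 2 a)) * extended_volume vol"
      by (simp add: lie_derivative_zero g \<open>\<phi> a = g\<close> const_diff)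
    then show ?thesis by (rule \<psi>)
  qed
  moreover have "\<psi> y1 = const (u 1 1 - q12) * y1 + const (u 1 2) * y2 + const (v 1 - w2)"
  proof (rule \<psi>)
    \<comment> \<open>As {y1, y1} = 0, the divergence is this derivative of -{y2, y1}, the source of
      \<open>- q12\<close> and \<open>- w2\<close>.\<close>
    have partial: "partial2 (brS y1 y2) = - (const q12 * y1 + const w2)"
      unfolding antisym[of y1 y2] br(3) by (simp add: partial_simps power2_eq_square)
    have "lie_derivative (\<alpha> 1 1) vol = fun_form (u 1 1) * vol"
      "lie_derivative (\<alpha> 1 2) vol = fun_form (u 1 2) * vol"
      "lie_derivative (\<nu> 1) vol = fun_form (v 1) * vol"
      using assms(8,9) by blast+
    note lie[OF br(4) ders(1)[of 1] ders(2)[of 1] ders(3)[of 1] this]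
    then show "lie_derivative (brS y1) (extended_volume vol) =
        fun_form (const (u 1 1 - q12) * y1 + const (u 1 2) * y2 + const (v 1 - w2)) *
          extended_volume vol"
      by (simp add: self partial partial_simps const_diff left_diff_distrib algebra_simps)
  qed
  moreover have "\<psi> y2 = const (u 2 1 + 2 * q11) * y1 + const (u 2 2 + q12) * y2 + const (v 2 + w1)"
  proof (rule \<psi>)
    \<comment> \<open>As {y2, y2} = 0, this is the whole divergence; the factor 2 comes from the
      square of \<open>y1\<close>.\<close>
    have partial: "partial1 (brS y2 y1) = const (2 * q11) * y1 + const q12 * y2 + const w1"
      unfolding br(3) by (simp add: partial_simps power2_eq_square const_2 const_hom algebra_simps)
    have "lie_derivative (\<alpha> 2 1) vol = fun_form (u 2 1) * vol"
      "lie_derivative (\<alpha> 2 2) vol = fun_form (u 2 2) * vol"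
      "lie_derivative (\<nu> 2) vol = fun_form (v 2) * vol"
      using assms(8,9) by blast+
    note lie[OF br(5) ders(1)[of 2] ders(2)[of 2] ders(3)[of 2] this]
    then show "lie_derivative (brS y2) (extended_volume vol) =
        fun_form (const (u 2 1 + 2 * q11) * y1 + const (u 2 2 + q12) * y2 + const (v 2 + w1)) *
          extended_volume vol"
      by (simp add: self partial partial_simps const_2 const_hom algebra_simps)
  qed
  ultimately show ?thesis by blast
qed

end
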